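(* Let $k$ and $t$ be integers with $k\geq 2$ and $1\leq t\leq k-1$, and let $G$ be a $t$-connected graph of order $n$ with $$n\geq\frac{(2k^{2}+5k+1)t+k^{2}+5k+2}{2k}.$$ If $$|E(G)|>\binom{n-\left\lfloor\left(k+\frac{1}{2}\right)t\right\rfloor-1}{2}+t\left(\left\lfloor\left(k+\frac{1}{2}\right)t\right\rfloor+1\right),$$ then $G$ has a $\{K_{1,1},K_{1,2},\ldots,K_{1,k},\mathcal{T}(2k+1)\}$-factor.
   Context: All graphs are finite, undirected, without loops or multiple edges. $K_{1,j}$ denotes the star with $j$ leaves. For a set $\mathcal{H}$ of connected graphs, an $\mathcal{H}$-factor of $G$ is a spanning subgraph of $G$ each of whose connected components is isomorphic to an element of $\mathcal{H}$. The family $\mathcal{T}(2k+1)$ ($k\geq2$) is defined as follows. For a tree $T$, $Leaf(T)$ is its set of leaves. Let $R$ be a tree such that for every $x\in V(R)\setminus Leaf(R)$: (a) $d_{R-Leaf(R)}(x)\in\{1,3,\ldots,2k+1\}$, and (b) $2\cdot(\text{number of leaves of } R \text{ adjacent to } x)+d_{R-Leaf(R)}(x)\leq 2k+1$. From such $R$ build a tree $T_R$ by (c) inserting a new vertex of degree 2 into each edge of $R-Leaf(R)$, and (d) for every vertex $x$ of $R-Leaf(R)$ with $d_{R-Leaf(R)}(x)=2r+1<2k+1$, attaching $k-r-(\text{number of leaves of } R \text{ adjacent to } x)$ new pendant edges to $x$. Then $\mathcal{T}(2k+1)$ is the set of all trees $T_R$ over all trees $R$ satisfying (a) and (b). A $\{K_{1,1},\ldots,K_{1,k},\mathcal{T}(2k+1)\}$-factor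 is an $\mathcal{H}$-factor with $\mathcal{H}=\{K_{1,1},\ldots,K_{1,k}\}\cup\mathcal{T}(2k+1)$. *)

theory Defs
  imports Complex_Main
begin

section \<open>Finite simple graphs\<close>

record 'a graph =
  verts :: "'a set"
  edges :: "'a set set"

definition simple_graph :: "'a graph \<Rightarrow> bool" where
  "simple_graph G \<longleftrightarrow> finite (verts G) \<and> edges G \<subseteq> {e. e \<subseteq> verts G \<and> card e = 2}"

definition degree :: "'a graph \<Rightarrow> 'a \<Rightarrow> nat" where
  "degree G v = card {e \<in> edges G. v \<in> e}"

definition induced :: "'a graph \<Rightarrow> 'a set \<Rightarrow> 'a graph" where
  "induced G S = \<lparr>verts = S, edges = {e \<in> edges G. e \<subseteq> S}\<rparr>"

definition del_verts :: "'a graph \<Rightarrow> 'a set \<Rightarrow> 'a graph" where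
  "del_verts G S = induced G (verts G - S)"

definition reachable :: "'a graph \<Rightarrow> 'a \<Rightarrow> 'a \<Rightarrow> bool" where
  "reachable G = (\<lambda>u v. {u, v} \<in> edges G)\<^sup>*\<^sup>*"

definition connected_graph :: "'a graph \<Rightarrow> bool" where
  "connected_graph G \<longleftrightarrow> verts G \<noteq> {} \<and> (\<forall>u\<in>verts G. \<forall>v\<in>verts G. reachable G u v)"

text \<open>In the standard convention a \<open>t\<close>-connected graph has more than \<open>t\<close> vertices.\<close>

definition t_connected :: "nat \<Rightarrow> 'a graph \<Rightarrow> bool" where
  "t_connected t G \<longleftrightarrow> t < card (verts G) \<and>
     (\<forall>S\<subseteq>verts G. card S < t \<longrightarrow> connected_graph (del_verts G S))"

definition components :: "'a graph \<Rightarrow> 'a graph set" where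
  "components G = {induced G {u \<in> verts G. reachable G v u} | v. v \<in> verts G}"

definition is_cycle :: "'a graph \<Rightarrow> 'a list \<Rightarrow> bool" where
  "is_cycle G p \<longleftrightarrow> 3 \<le> length p \<and> distinct p \<and>
     (\<forall>i<length p. {p ! i, p ! (Suc i mod length p)} \<in> edges G)"

definition tree :: "'a graph \<Rightarrow> bool" where
  "tree G \<longleftrightarrow> simple_graph G \<and> connected_graph G \<and> (\<nexists>p. is_cycle G p)"

definition isomorphic :: "'a graph \<Rightarrow> 'b graph \<Rightarrow> bool" where
  "isomorphic G H \<longleftrightarrow> (\<exists>f. bij_betw f (verts G) (verts H) \<and>
     (\<forall>u\<in>verts G. \<forall>v\<in>verts G. {u, v} \<in> edges G \<longleftrightarrow> {f u, f v} \<in> edges H))"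

definition spanning_subgraph :: "'a graph \<Rightarrow> 'a graph \<Rightarrow> bool" where
  "spanning_subgraph F G \<longleftrightarrow> verts F = verts G \<and> edges F \<subseteq> edges G"

definition is_factor :: "'b graph set \<Rightarrow> 'a graph \<Rightarrow> 'a graph \<Rightarrow> bool" where
  "is_factor \<H> F G \<longleftrightarrow> spanning_subgraph F G \<and> (\<forall>C\<in>components F. \<exists>H\<in>\<H>. isomorphic C H)"

definition has_factor :: "'b graph set \<Rightarrow> 'a graph \<Rightarrow> bool" where
  "has_factor \<H> G \<longleftrightarrow> (\<exists>F. is_factor \<H> F G)"

section \<open>Stars and the family \<open>\<T>(2k+1)\<close>\<close>

definition star :: "nat \<Rightarrow> nat graph" where
  "star j = \<lparr>verts = {0..j}, edges = {{0, i} | i. i \<in> {1..j}}\<rparr>"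

definition Leaf :: "'a graph \<Rightarrow> 'a set" where
  "Leaf T = {v \<in> verts T. degree T v = 1}"

definition core :: "'a graph \<Rightarrow> 'a graph" where
  "core R = del_verts R (Leaf R)"

definition num_leaves :: "'a graph \<Rightarrow> 'a \<Rightarrow> nat" where
  "num_leaves R x = card {y \<in> Leaf R. {x, y} \<in> edges R}"

definition admissible :: "nat \<Rightarrow> 'a graph \<Rightarrow> bool" where
  "admissible k R \<longleftrightarrow> tree R \<and>
     (\<forall>x \<in> verts R - Leaf R.
        degree (core R) x \<in> {2 * i + 1 | i. i \<le> k} \<and>
        2 * num_leaves R x + degree (core R) x \<le> 2 * k + 1)"

text \<open>
  Vertices of \<open>T_R\<close>: those of \<open>R\<close> (leaves included), a subdivision vertex \<open>Mid e\<close> for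
  every edge \<open>e\<close> of \<open>R - Leaf(R)\<close>, and the new leaves \<open>Pend x i\<close> attached at \<open>x\<close>. The
  natural-number subtraction in \<open>num_new\<close> does not truncate when \<open>R\<close> is admissible.
\<close>

datatype 'a tvertex = Orig 'a | Mid "'a set" | Pend 'a nat

definition num_new :: "nat \<Rightarrow> 'a graph \<Rightarrow> 'a \<Rightarrow> nat" where
  "num_new k R x =
     (if degree (core R) x < 2 * k + 1
      then k - (degree (core R) x - 1) div 2 - num_leaves R x else 0)"

definition tree_of :: "nat \<Rightarrow> 'a graph \<Rightarrow> 'a tvertex graph" where
  "tree_of k R =
     \<lparr>verts = Orig ` verts R \<union> Mid ` edges (core R) \<union>
              {Pend x i | x i. x \<in> verts (core R) \<and> i < num_new k R x},
      edges = image Orig ` (edges R - edges (core R)) \<union>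
              {{Orig x, Mid e} | x e. e \<in> edges (core R) \<and> x \<in> e} \<union>
              {{Orig x, Pend x i} | x i. x \<in> verts (core R) \<and> i < num_new k R x}\<rparr>"

text \<open>
  \<open>T_family k\<close> is \<open>\<T>(2k+1)\<close>. The names of the vertices of \<open>R\<close> and of \<open>T_R\<close> are immaterial,
  so the family consists of all copies of the trees \<open>T_R\<close> on finite sets of natural numbers;
  up to isomorphism every finite graph occurs on such a set.
\<close>

definition T_family :: "nat \<Rightarrow> nat graph set" where
  "T_family k = {T. simple_graph T \<and> (\<exists>R :: nat graph. admissible k R \<and> isomorphic (tree_of k R) T)}"

end

theory Submission
  imports Defs
begin

text \<open>
  A set \<open>X\<close> leaving more than \<open>(k + 1/2) |X|\<close> isolated vertices would force \<open>|X| \<ge> t\<close> and too few edges,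
  so it suffices that \<open>i(G - X) \<le> (k + 1/2) |X|\<close> for all \<open>X\<close> yields the factor. Let \<open>S\<close> maximise
  \<open>i(G - S) - k |S|\<close> and let \<open>I\<close> be the isolated vertices of \<open>G - S\<close>. By maximality the graph on the
  remaining vertices satisfies \<open>i \<le> k |X|\<close> and splits into stars with at most \<open>k\<close> leaves: a star
  partition that is optimal for a convex cost has no larger star. Every vertex of \<open>I\<close> distributes
  two tokens among its neighbours in \<open>S\<close>; a balanced distribution gives each vertex of \<open>S\<close> a load of
  \<open>2k\<close> or \<open>2k + 1\<close>. Regard the vertices of \<open>I\<close> with split tokens as edges between vertices of \<open>S\<close>. If
  their number is minimal they form a forest all of whose non-trivial components have loads \<open>2k + 1\<close>
  only. Those components are the trees \<open>T\<^sub>R\<close>, and the trivial ones are stars with \<open>k\<close> leaves.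
\<close>

section \<open>Shifting tokens along paths\<close>

text \<open>Doubling the vertices of \<open>I\<close> makes the capacity \<open>k + 1/2\<close>
  integral: the hypothesis becomes a Hall condition with upper bound \<open>2 * k + 1\<close>.
  Maximality of \<open>S\<close>, tested against its subsets, is a second Hall condition with lower
  bound \<open>2 * k\<close>, so only two consecutive loads remain. Parity separates them. A
  receiver of load \<open>2 * k + 1\<close> with p unsplit neighbours meets
  \<open>2 * k + 1 - 2 * p\<close> split ones; this odd number is its degree in the core of
  \<open>R\<close>, and (b) holds with equality. The obstacle is that a balanced assignment may
  close cycles of split vertices, or split a vertex at a receiver of load \<open>2 * k\<close>. Both
  are repaired by pushing tokens only between the current receivers of each vertex: such a push
  never splits a vertex and, when it changes a load, unsplits one. The bound on \<open>n\<close> is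
  what the comparison of edge counts requires for even \<open>t\<close> and
  \<open>card X = t + 1\<close>. Larger sets are handled by \<open>t \<le> k - 1\<close> and by the
  room that \<open>X\<close> and the isolated vertices occupy in the graph.\<close>

definition fiber :: "'x set \<Rightarrow> ('x \<Rightarrow> 'c) \<Rightarrow> 'c \<Rightarrow> 'x set" where
  "fiber X f c = {x \<in> X. f x = c}"

text \<open>\<open>shift_step X N f a c\<close>: moving one token lets \<open>a\<close> gain what \<open>c\<close> loses.\<close>

definition shift_step :: "'x set \<Rightarrow> ('x \<Rightarrow> 'c set) \<Rightarrow> ('x \<Rightarrow> 'c) \<Rightarrow> 'c \<Rightarrow> 'c \<Rightarrow> bool" where
  "shift_step X N f a c \<longleftrightarrow> (\<exists>x\<in>X. f x = c \<and> a \<in> N x)"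

lemma card_fiber_upd:
  assumes "finite X" "x \<in> X"
  shows "int (card (fiber X (f(x := a)) c)) =
    int (card (fiber X f c)) + of_bool (c = a) - of_bool (c = f x)"
proof -
  let ?F = "fiber (X - {x}) f c"
  have fin: "finite ?F" and notin: "x \<notin> ?F" using assms by (auto simp: fiber_def)
  have 1: "fiber X f c = (if c = f x then insert x ?F else ?F)"
    using assms by (auto simp: fiber_def)
  have 2: "fiber X (f(x := a)) c = (if c = a then insert x ?F else ?F)"
    using assms by (auto simp: fiber_def)
  show ?thesis unfolding 1 2 using fin notin by auto
qed

text \<open>One token moves from \<open>b\<close> to its predecessor \<open>c\<close> on the path;
  the rest of the path is treated by induction for the changed assignment. A shortest path does not
  meet \<open>b\<close> earlier, so its other arrows rest on tokens that have not moved. The gains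
  and losses of inner receivers cancel. The clause that tokens at \<open>a\<close> stay there is
  what the star argument needs: old leaves of \<open>a\<close> remain its leaves.\<close>

lemma path_shift:
  assumes fin: "finite X" and "\<And>x. x \<in> X \<Longrightarrow> f x \<in> N x"
    and "(shift_step X N f)\<^sup>*\<^sup>* a b" "a \<noteq> b"
  shows "\<exists>g. (\<forall>x\<in>X. g x \<in> N x) \<and> (\<forall>x\<in>X. f x = a \<longrightarrow> g x = a) \<and>
    (\<forall>c. int (card (fiber X g c)) = int (card (fiber X f c)) + of_bool (c = a) - of_bool (c = b))"
proof -
  from assms(3) obtain n where "(shift_step X N f ^^ n) a b"
    by (auto simp: rtranclp_power)
  then show ?thesis using assms(2,4)
  proof (induction n arbitrary: f b rule: less_induct)
    case (less n)
    show ?case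
    proof (cases "\<exists>m<n. (shift_step X N f ^^ m) a b")
      case True
      then show ?thesis using less.IH less.prems by blast
    next
      case False
      from less.prems(1,3) obtain m where n: "n = Suc m" by (cases n) auto
      then obtain c where c: "(shift_step X N f ^^ m) a c" "shift_step X N f c b"
        using less.prems(1) by auto
      then obtain x where x: "x \<in> X" "f x = b" "c \<in> N x" by (auto simp: shift_step_def)
      have "c \<noteq> b" using False c n by auto
      define f' where "f' = f(x := c)"
      have path: "(shift_step X N f' ^^ i) a p" if "(shift_step X N f ^^ i) a p" "i < n" for i p
        using that
      proof (induction i arbitrary: p)
        case (Suc i)
        then obtain q where q: "(shift_step X N f ^^ i) a q" "shift_step X N f q p" by auto
        have "p \<noteq> b" using Suc.prems False by blast
        then have "shift_step X N f' q p" using q(2) x by (auto simp: shift_step_def f'_def)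
        with q(1) Suc show ?case by auto
      qed simp
      have val': "f' y \<in> N y" if "y \<in> X" for y using less.prems(2) x that by (auto simp: f'_def)
      have load': "int (card (fiber X f' d)) =
          int (card (fiber X f d)) + of_bool (d = c) - of_bool (d = b)" for d
        unfolding f'_def using card_fiber_upd[OF fin x(1), of f c d] x(2) by simp
      have keep: "f' y = a" if "f y = a" for y using that x less.prems(3) by (auto simp: f'_def)
      show ?thesis
      proof (cases "a = c")
        case True
        then show ?thesis using val' load' keep by (intro exI[of _ f']) auto
      next
        case ac: False
        have "(shift_step X N f' ^^ m) a c" using path c n by auto
        then obtain g where g: "\<forall>x\<in>X. g x \<in> N x" "\<forall>x\<in>X. f' x = a \<longrightarrow> g x = a"
          "\<forall>d. int (card (fiber X g d)) = int (card (fiber X f' d)) + of_bool (d = a) - of_bool (d = c)"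
          using less.IH[of m f' c] n val' ac by auto
        then show ?thesis using load' keep by (intro exI[of _ g]) auto
      qed
    qed
  qed
qed

section \<open>Assignments with loads between two bounds\<close>

lemma sum_change_on:
  fixes g g' :: "'c \<Rightarrow> nat"
  assumes "finite S" "A \<subseteq> S" "\<And>c. c \<in> S - A \<Longrightarrow> g' c = g c"
  shows "sum g' S + sum g A = sum g S + sum g' A"
proof -
  have "sum g' (S - A) = sum g (S - A)" using assms by (intro sum.cong) auto
  then show ?thesis using sum.subset_diff[OF assms(2,1), of g] sum.subset_diff[OF assms(2,1), of g'] by simp
qed

lemma sum_card_fiber:
  assumes "finite X" "finite Z"
  shows "(\<Sum>c\<in>Z. card (fiber X f c)) = card {x \<in> X. f x \<in> Z}"
proof -
  have "card {x \<in> X. f x \<in> Z} = card (\<Union>c\<in>Z. fiber X f c)"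
    by (rule arg_cong[of _ _ card]) (auto simp: fiber_def)
  also have "\<dots> = (\<Sum>c\<in>Z. card (fiber X f c))"
    using assms by (intro card_UN_disjoint) (auto simp: fiber_def)
  finally show ?thesis by simp
qed

lemma sum_card_fiber_lower:
  assumes "finite X" "finite Z" "s \<in> Z" "\<And>c. c \<in> Z \<Longrightarrow> u \<le> card (fiber X f c)"
    "u < card (fiber X f s)"
  shows "u * card Z < card {x \<in> X. f x \<in> Z}"
proof -
  have "(\<Sum>c\<in>Z. u) < (\<Sum>c\<in>Z. card (fiber X f c))"
    using assms by (intro sum_strict_mono_ex1) auto
  then show ?thesis using assms by (simp add: sum_card_fiber mult.commute)
qed

lemma sum_card_fiber_upper:
  assumes "finite X" "finite Z" "s \<in> Z" "\<And>c. c \<in> Z \<Longrightarrow> card (fiber X f c) \<le> l"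
    "card (fiber X f s) < l"
  shows "card {x \<in> X. f x \<in> Z} < l * card Z"
proof -
  have "(\<Sum>c\<in>Z. card (fiber X f c)) < (\<Sum>c\<in>Z. l)"
    using assms by (intro sum_strict_mono_ex1) auto
  then show ?thesis using assms by (simp add: sum_card_fiber mult.commute)
qed

lemma rtranclp_closed:
  assumes "r\<^sup>*\<^sup>* a b" "b \<in> S" "\<And>x y. r x y \<Longrightarrow> x \<in> S"
  shows "a \<in> S"
  using assms by (metis converse_rtranclpE)

text \<open>One minimiser of the sum of squared loads meets both bounds: along a path the receiver
  that would lose has at most one token more than the one that would gain. A load above
  \<open>u\<close> then produces a set of receivers, closed under gaining, with average load above
  \<open>u\<close>; a load below \<open>l\<close> produces one, closed under giving, with average
  below \<open>l\<close>.\<close>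

lemma balanced_assignment:
  assumes fin: "finite X" "finite S" and N: "\<And>x. x \<in> X \<Longrightarrow> N x \<subseteq> S" "\<And>x. x \<in> X \<Longrightarrow> N x \<noteq> {}"
    and upper: "\<And>Y. Y \<subseteq> S \<Longrightarrow> card {x \<in> X. N x \<subseteq> Y} \<le> u * card Y"
    and lower: "\<And>Y. Y \<subseteq> S \<Longrightarrow> l * card Y \<le> card {x \<in> X. N x \<inter> Y \<noteq> {}}"
    and "l \<le> u"
  obtains f where "\<And>x. x \<in> X \<Longrightarrow> f x \<in> N x"
    "\<And>s. s \<in> S \<Longrightarrow> l \<le> card (fiber X f s)" "\<And>s. s \<in> S \<Longrightarrow> card (fiber X f s) \<le> u"
proof -
  let ?V = "\<lambda>f. \<forall>x\<in>X. f x \<in> N x"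
  let ?c = "\<lambda>f. \<Sum>s\<in>S. (card (fiber X f s))\<^sup>2"
  have "?V (\<lambda>x. SOME y. y \<in> N x)" using N(2) by (auto simp: some_in_eq)
  then have "\<exists>f. ?V f \<and> (\<forall>g. ?V g \<longrightarrow> ?c f \<le> ?c g)" by (rule ex_has_least_nat[of ?V _ ?c])
  then obtain f where f: "?V f" and min: "\<And>g. ?V g \<Longrightarrow> ?c f \<le> ?c g" by auto
  let ?r = "shift_step X N f"
  have inS: "s \<in> S" if "?r s s'" for s s' using that N by (auto simp: shift_step_def)
  have reach: "card (fiber X f b) \<le> Suc (card (fiber X f a))" if ab: "?r\<^sup>*\<^sup>* a b" "b \<in> S" for a b
  proof (cases "a = b")
    case False
    have "a \<in> S" using rtranclp_closed[OF ab] inS by blast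
    have "f x \<in> N x" if "x \<in> X" for x using f that by blast
    from path_shift[OF fin(1) this ab(1) False]
    obtain g where g: "?V g" "\<And>c. int (card (fiber X g c)) =
        int (card (fiber X f c)) + of_bool (c = a) - of_bool (c = b)" by blast
    have ga: "card (fiber X g a) = Suc (card (fiber X f a))"
      and gb: "Suc (card (fiber X g b)) = card (fiber X f b)"
      using g(2)[of a] g(2)[of b] False by auto
    \<comment> \<open>Only the summands at \<open>a\<close> and \<open>b\<close> change, in total by
      twice (load of \<open>a\<close> - load of \<open>b\<close> + 1).\<close>
    have "?c g + (\<Sum>s\<in>{a,b}. (card (fiber X f s))\<^sup>2) = ?c f + (\<Sum>s\<in>{a,b}. (card (fiber X g s))\<^sup>2)"
      using fin \<open>a \<in> S\<close> \<open>b \<in> S\<close> g(2) by (intro sum_change_on) (auto simp: of_nat_eq_iff[symmetric, where 'a=int])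
    with min[OF g(1)] False have "(card (fiber X f a))\<^sup>2 + (card (fiber X f b))\<^sup>2
        \<le> (card (fiber X g a))\<^sup>2 + (card (fiber X g b))\<^sup>2" by simp
    then show ?thesis unfolding ga gb[symmetric] by (simp add: power2_eq_square)
  qed auto
  have "card (fiber X f s) \<le> u" if "s \<in> S" for s
  proof (rule ccontr)
    assume big: "\<not> ?thesis"
    define Z where "Z = {c. ?r\<^sup>*\<^sup>* c s}"
    have ZS: "Z \<subseteq> S"
    proof
      fix c assume "c \<in> Z"
      then have "?r\<^sup>*\<^sup>* c s" by (simp add: Z_def)
      from rtranclp_closed[OF this \<open>s \<in> S\<close>] inS show "c \<in> S" by blast
    qed
    have "u * card Z < card {x \<in> X. f x \<in> Z}"
    proof (rule sum_card_fiber_lower)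
      show "u \<le> card (fiber X f c)" if "c \<in> Z" for c
        using reach[of c s] that big \<open>s \<in> S\<close> by (auto simp: Z_def)
    qed (use fin ZS big finite_subset in \<open>auto simp: Z_def\<close>)
    \<comment> \<open>A token held in \<open>Z\<close> has all its possible receivers in
      \<open>Z\<close>, since each of them could gain it.\<close>
    also have "\<dots> \<le> card {x \<in> X. N x \<subseteq> Z}"
    proof (intro card_mono subsetI)
      fix x assume x: "x \<in> {x \<in> X. f x \<in> Z}"
      have "c \<in> Z" if "c \<in> N x" for c
      proof -
        have "?r c (f x)" using that x by (auto simp: shift_step_def)
        then show ?thesis using x by (auto simp: Z_def intro: converse_rtranclp_into_rtranclp)
      qed
      with x show "x \<in> {x \<in> X. N x \<subseteq> Z}" by auto
    qed (use fin in auto)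
    also have "\<dots> \<le> u * card Z" using upper ZS by blast
    finally show False by simp
  qed
  moreover have "l \<le> card (fiber X f s)" if "s \<in> S" for s
  proof (rule ccontr)
    assume small: "\<not> ?thesis"
    define Z where "Z = {c \<in> S. ?r\<^sup>*\<^sup>* s c}"
    have ZS: "Z \<subseteq> S" by (auto simp: Z_def)
    \<comment> \<open>Dually, a token that could be sent into \<open>Z\<close> is already held
      there, since its holder could give it up.\<close>
    have "card {x \<in> X. N x \<inter> Z \<noteq> {}} \<le> card {x \<in> X. f x \<in> Z}"
    proof (intro card_mono subsetI)
      fix x assume "x \<in> {x \<in> X. N x \<inter> Z \<noteq> {}}"
      then obtain c where c: "x \<in> X" "c \<in> N x" "?r\<^sup>*\<^sup>* s c" by (auto simp: Z_def)
      then have "?r c (f x)" by (auto simp: shift_step_def)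
      with c f N show "x \<in> {x \<in> X. f x \<in> Z}" by (auto simp: Z_def intro: rtranclp.rtrancl_into_rtrancl)
    qed (use fin in auto)
    also have "\<dots> < l * card Z"
    proof (rule sum_card_fiber_upper)
      show "card (fiber X f c) \<le> l" if "c \<in> Z" for c
        using reach[of s c] that small by (auto simp: Z_def)
    qed (use fin ZS small finite_subset \<open>s \<in> S\<close> in \<open>auto simp: Z_def\<close>)
    finally show False using lower[OF ZS] by simp
  qed
  ultimately show thesis using that f by blast
qed

section \<open>Star partitions\<close>

definition isol :: "'a set set \<Rightarrow> 'a set \<Rightarrow> 'a set" where
  "isol E U = {v \<in> U. \<forall>u\<in>U. {u, v} \<notin> E}"

text \<open>A partition into stars is encoded by the map sending each vertex to the centre of its star.\<close>

definition star_map :: "'a set set \<Rightarrow> 'a set \<Rightarrow> ('a \<Rightarrow> 'a) \<Rightarrow> bool" where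
  "star_map E W h \<longleftrightarrow> (\<forall>v\<in>W. h v \<in> W \<and> h (h v) = h v \<and> (h v \<noteq> v \<longrightarrow> {v, h v} \<in> E))"

text \<open>
  The weight of a star with \<open>m\<close> vertices in a graph with \<open>n\<close> vertices. A single vertex is so expensive
  that merging it into another star always pays off.
\<close>

definition star_weight :: "nat \<Rightarrow> nat \<Rightarrow> nat" where
  "star_weight n m = (if m = 0 then 0 else if m = 1 then 2 * n + 2 else (m - 1)\<^sup>2)"

definition star_cost :: "'a set \<Rightarrow> ('a \<Rightarrow> 'a) \<Rightarrow> nat" where
  "star_cost W h = (\<Sum>c\<in>W. star_weight (card W) (card (fiber W h c)))"

lemma star_cost_change:
  assumes "finite W" "A \<subseteq> W" "\<And>c. c \<in> W - A \<Longrightarrow> card (fiber W h' c) = card (fiber W h c)"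
  shows "star_cost W h' + (\<Sum>c\<in>A. star_weight (card W) (card (fiber W h c)))
    = star_cost W h + (\<Sum>c\<in>A. star_weight (card W) (card (fiber W h' c)))"
  unfolding star_cost_def using assms by (intro sum_change_on) auto

text \<open>A locale, because the consequences of minimality are later applied to two different
  optimal maps at once.\<close>

locale min_star_map =
  fixes E :: "'a set set" and W :: "'a set" and h :: "'a \<Rightarrow> 'a"
  assumes fin: "finite W" and loopfree: "\<And>v. {v} \<notin> E"
    and map: "star_map E W h"
    and min: "\<And>h'. star_map E W h' \<Longrightarrow> star_cost W h \<le> star_cost W h'"
begin

abbreviation "size_at c \<equiv> card (fiber W h c)"

lemma size_pos:
  assumes "v \<in> W" shows "size_at (h v) \<ge> 1"
proof -
  have "v \<in> fiber W h (h v)" using assms by (simp add: fiber_def)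
  then show ?thesis using fin by (auto simp: fiber_def Suc_le_eq card_gt_0_iff)
qed

lemma size_two:
  assumes "v \<in> W" "h v \<noteq> v" shows "size_at (h v) \<ge> 2"
proof -
  have "{v, h v} \<subseteq> fiber W h (h v)" using assms map by (auto simp: fiber_def star_map_def)
  moreover have "finite (fiber W h (h v))" using fin by (auto simp: fiber_def)
  ultimately have "card {v, h v} \<le> size_at (h v)" by (rule card_mono[rotated])
  then show ?thesis using assms by simp
qed

lemma size_le: "size_at c \<le> card W"
  using fin by (intro card_mono) (auto simp: fiber_def)

lemma fiber_noncenter:
  assumes "h y \<noteq> y" shows "fiber W h y = {}"
  using assms map by (auto simp: fiber_def star_map_def)

lemma fiber_two:
  assumes "v \<in> W" "h v \<noteq> v" "size_at (h v) = 2" shows "fiber W h (h v) = {v, h v}"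
proof -
  have "{v, h v} \<subseteq> fiber W h (h v)" using assms map by (auto simp: fiber_def star_map_def)
  moreover have "finite (fiber W h (h v))" using fin by (auto simp: fiber_def)
  moreover have "card {v, h v} = 2" using assms by auto
  ultimately show ?thesis using assms by (metis card_subset_eq)
qed

lemma pair_weights:
  assumes "star_map E W h'" "A \<subseteq> W" "\<And>c. c \<in> W - A \<Longrightarrow> card (fiber W h' c) = size_at c"
  shows "(\<Sum>c\<in>A. star_weight (card W) (size_at c)) \<le> (\<Sum>c\<in>A. star_weight (card W) (card (fiber W h' c)))"
  using star_cost_change[OF fin assms(2,3)] min[OF assms(1)] by linarith

section \<open>Local improvements of an optimal star map\<close>

lemma star_weight_simps:
  "star_weight n 0 = 0" "star_weight n (Suc 0) = 2 * n + 2" "star_weight n (Suc (Suc m)) = (Suc m)\<^sup>2"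
  by (auto simp: star_weight_def)

text \<open>The condition on \<open>fiber W h x\<close> admits a leaf \<open>x\<close> as well as a
  trivial star, so one exchange serves both results below. The count is over \<open>int\<close>
  because \<open>h x\<close> and \<open>h y\<close> may coincide and then lose two vertices.\<close>

lemma join_star:
  assumes "x \<in> W" "y \<in> W" "{y, x} \<in> E" "fiber W h x \<subseteq> {x}" "h y \<noteq> y"
  shows "star_map E W (h(x := y, y := y))"
    and "int (card (fiber W (h(x := y, y := y)) c)) =
      int (size_at c) + 2 * of_bool (c = y) - of_bool (c = h x) - of_bool (c = h y)"
proof -
  have "x \<noteq> y" using assms loopfree[of x] by auto
  have hxy: "h v \<noteq> x \<and> h v \<noteq> y" if "v \<in> W" "v \<noteq> x" "v \<noteq> y" for v
    using that assms fiber_noncenter[OF assms(5)] by (auto simp: fiber_def)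
  show "star_map E W (h(x := y, y := y))"
    using map hxy assms by (auto simp: star_map_def insert_commute)
  show "int (card (fiber W (h(x := y, y := y)) c)) =
      int (size_at c) + 2 * of_bool (c = y) - of_bool (c = h x) - of_bool (c = h y)"
    using card_fiber_upd[OF fin assms(2), of "h(x := y)" y c]
      card_fiber_upd[OF fin assms(1), of h y c] \<open>x \<noteq> y\<close> by simp
qed

text \<open>Detaching \<open>y\<close> from a two-vertex star would leave \<open>h y\<close> as an
  expensive trivial star. Taking \<open>y\<close> as the centre of both \<open>x\<close> and
  \<open>h y\<close> avoids this.\<close>

lemma recentre_star:
  assumes "x \<in> W" "y \<in> W" "{y, x} \<in> E" "fiber W h x \<subseteq> {x}" "h y \<noteq> y" "h y \<noteq> x" "h x \<noteq> h y"
    "size_at (h y) = 2"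
  shows "star_map E W (h(x := y, y := y, h y := y))"
    and "int (card (fiber W (h(x := y, y := y, h y := y)) c)) =
      int (size_at c) + 3 * of_bool (c = y) - of_bool (c = h x) - 2 * of_bool (c = h y)"
proof -
  let ?h = "h(x := y, y := y)"
  have z: "h y \<in> W" "h (h y) = h y" "{y, h y} \<in> E" using map assms by (auto simp: star_map_def)
  have "h v \<noteq> h y" if "v \<in> W" "v \<noteq> y" "v \<noteq> h y" for v
    using fiber_two[of y] that assms by (auto simp: fiber_def)
  then show "star_map E W (h(x := y, y := y, h y := y))"
    using join_star(1)[OF assms(1-5)] z assms by (auto simp: star_map_def insert_commute)
  show "int (card (fiber W (h(x := y, y := y, h y := y)) c)) =
      int (size_at c) + 3 * of_bool (c = y) - of_bool (c = h x) - 2 * of_bool (c = h y)"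
    using card_fiber_upd[OF fin z(1), of ?h y c] join_star(2)[OF assms(1-5), of c] z assms
    by auto
qed

text \<open>The neighbour \<open>y\<close> can absorb \<open>c\<close>: a centre takes it as a leaf,
  the leaf of a two-vertex star becomes the centre, and the leaf of a larger star leaves it to pair
  with \<open>c\<close>. The weight of the trivial star saved exceeds every increase
  elsewhere.\<close>

lemma no_trivial_star:
  assumes "c \<in> W" "h c = c" "y \<in> W" "{y, c} \<in> E"
  shows "size_at c \<noteq> 1"
proof
  assume c1: "size_at c = 1"
  have "y \<noteq> c" using loopfree assms by force
  have "{c, y} \<in> E" using assms by (simp add: insert_commute)
  have "c \<in> fiber W h c" using assms by (simp add: fiber_def)
  then have fc: "fiber W h c = {c}" using c1 by (metis card_1_singletonE singletonD)
  then have hc: "h v \<noteq> c" if "v \<in> W" "v \<noteq> c" for v using that by (auto simp: fiber_def)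
  show False
  proof (cases "h y = y")
    case True
    obtain m where m: "size_at y = Suc m"
      using size_pos[of y] True assms by (cases "size_at y") auto
    let ?h = "h(c := y)"
    have sz: "int (card (fiber W ?h d)) = int (size_at d) + of_bool (d = y) - of_bool (d = c)" for d
      using card_fiber_upd[OF fin assms(1), of h y d] assms by simp
    have "star_map E W ?h"
      using map hc \<open>{c, y} \<in> E\<close> assms True by (auto simp: star_map_def)
    then have "(\<Sum>d\<in>{c,y}. star_weight (card W) (size_at d))
        \<le> (\<Sum>d\<in>{c,y}. star_weight (card W) (card (fiber W ?h d)))"
      using assms sz by (intro pair_weights) (auto simp: of_nat_eq_iff[symmetric, where 'a=int])
    moreover have "card (fiber W ?h c) = 0" "card (fiber W ?h y) = Suc (Suc m)"
      using sz[of c] sz[of y] c1 m \<open>y \<noteq> c\<close> by auto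
    ultimately have "star_weight (card W) 1 + star_weight (card W) (Suc m)
        \<le> star_weight (card W) (Suc (Suc m))"
      using \<open>y \<noteq> c\<close> c1 m by (simp add: star_weight_simps)
    then show False using size_le[of y] m
      by (cases m) (auto simp: star_weight_simps power2_eq_square)
  next
    case False
    obtain m where m: "size_at (h y) = Suc (Suc m)"
      using size_two[OF assms(3) False] by (auto simp: le_iff_add)
    have "h y \<noteq> c" using m c1 by auto
    have "size_at y = 0" using fiber_noncenter[OF False] by simp
    have zW: "h y \<in> W" using map assms by (auto simp: star_map_def)
    show False
    proof (cases m)
      case 0
      let ?h = "h(c := y, y := y, h y := y)"
      note re = recentre_star[of c y, unfolded assms(2)]
      have sz: "star_map E W ?h" "\<And>d. int (card (fiber W ?h d)) =
        int (size_at d) + 3 * of_bool (d = y) - of_bool (d = c) - 2 * of_bool (d = h y)"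
        using re assms False \<open>h y \<noteq> c\<close> fc m 0 by auto
      have "(\<Sum>d\<in>{c,y,h y}. star_weight (card W) (size_at d))
        \<le> (\<Sum>d\<in>{c,y,h y}. star_weight (card W) (card (fiber W ?h d)))"
        using assms sz zW by (intro pair_weights) (auto simp: of_nat_eq_iff[symmetric, where 'a=int])
      moreover have "card (fiber W ?h c) = 0" "card (fiber W ?h y) = Suc (Suc (Suc 0))"
        "card (fiber W ?h (h y)) = 0"
        using sz(2)[of c] sz(2)[of y] sz(2)[of "h y"] \<open>size_at y = 0\<close> c1 m 0 \<open>y \<noteq> c\<close> False \<open>h y \<noteq> c\<close> by auto
      moreover have "card W > 0" using fin assms(1) by (auto simp: card_gt_0_iff)
      ultimately show False using \<open>y \<noteq> c\<close> False \<open>h y \<noteq> c\<close> c1 m 0 \<open>size_at y = 0\<close>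
        by (simp add: star_weight_simps power2_eq_square)
    next
      case (Suc l)
      let ?h = "h(c := y, y := y)"
      note re = join_star[of c y, unfolded assms(2)]
      have sz: "star_map E W ?h" "\<And>d. int (card (fiber W ?h d)) =
        int (size_at d) + 2 * of_bool (d = y) - of_bool (d = c) - of_bool (d = h y)"
        using re assms False fc by auto
      have "(\<Sum>d\<in>{c,y,h y}. star_weight (card W) (size_at d))
        \<le> (\<Sum>d\<in>{c,y,h y}. star_weight (card W) (card (fiber W ?h d)))"
        using assms sz zW by (intro pair_weights) (auto simp: of_nat_eq_iff[symmetric, where 'a=int])
      moreover have "card (fiber W ?h c) = 0" "card (fiber W ?h y) = Suc (Suc 0)"
        "card (fiber W ?h (h y)) = Suc (Suc l)"
        using sz(2)[of c] sz(2)[of y] sz(2)[of "h y"] \<open>size_at y = 0\<close> c1 m Suc \<open>y \<noteq> c\<close> False \<open>h y \<noteq> c\<close> by auto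
      ultimately show False using \<open>y \<noteq> c\<close> False \<open>h y \<noteq> c\<close> c1 m Suc \<open>size_at y = 0\<close>
        by (simp add: star_weight_simps power2_eq_square)
    qed
  qed
qed

text \<open>If \<open>y\<close> were a leaf too, \<open>x\<close> and \<open>y\<close> could leave
  their stars and form a new one, together with \<open>h y\<close> when that has no other leaf. This
  pays off from three leaves at \<open>h x\<close> on, hence the bound 4; with two leaves the last
  case trades weights \<open>4 + 1\<close> for \<open>1 + 4\<close>.\<close>

lemma leaf_neighbours:
  assumes "x \<in> W" "h x \<noteq> x" "size_at (h x) \<ge> 4" "y \<in> W" "{y, x} \<in> E"
  shows "h y = y"
proof (rule ccontr)
  assume y: "h y \<noteq> y"
  obtain m where m: "size_at (h x) = Suc (Suc (Suc (Suc m)))"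
    using assms(3) by (auto simp: le_iff_add numeral_eq_Suc)
  have W: "h x \<in> W" "h y \<in> W" "h (h x) = h x" "h (h y) = h y" using map assms by (auto simp: star_map_def)
  have fx: "fiber W h x \<subseteq> {x}" using fiber_noncenter[OF assms(2)] by simp
  have y0: "size_at y = 0" using fiber_noncenter[OF y] by simp
  have ne: "h x \<noteq> y" "h y \<noteq> x" using W y assms by auto
  let ?h = "h(x := y, y := y)"
  note sz = join_star[OF assms(1,4,5) fx y]
  have *: "(\<Sum>d\<in>{y,h x,h y}. star_weight (card W) (size_at d))
      \<le> (\<Sum>d\<in>{y,h x,h y}. star_weight (card W) (card (fiber W ?h d)))"
    using assms sz W by (intro pair_weights) (auto simp: of_nat_eq_iff[symmetric, where 'a=int])
  show False
  proof (cases "h x = h y")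
    case True
    then have "card (fiber W ?h y) = Suc (Suc 0)" "card (fiber W ?h (h y)) = Suc (Suc m)"
      using sz(2)[of y] sz(2)[of "h y"] y0 m y ne by auto
    with * True m y y0 show False by (simp add: star_weight_simps power2_eq_square)
  next
    case False
    obtain l where l: "size_at (h y) = Suc (Suc l)"
      using size_two[OF assms(4) y] by (auto simp: le_iff_add)
    show False
    proof (cases l)
      case 0
      let ?g = "h(x := y, y := y, h y := y)"
      have l2: "size_at (h y) = 2" using l 0 by simp
      note rz = recentre_star[OF assms(1,4,5) fx y ne(2) False l2]
      have "(\<Sum>d\<in>{y,h x,h y}. star_weight (card W) (size_at d))
        \<le> (\<Sum>d\<in>{y,h x,h y}. star_weight (card W) (card (fiber W ?g d)))"
        using assms rz W by (intro pair_weights) (auto simp: of_nat_eq_iff[symmetric, where 'a=int])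
      moreover have "card (fiber W ?g y) = Suc (Suc (Suc 0))" "card (fiber W ?g (h y)) = 0"
        "card (fiber W ?g (h x)) = Suc (Suc (Suc m))"
        using rz(2)[of y] rz(2)[of "h y"] rz(2)[of "h x"] y0 m l2 y ne False by auto
      ultimately show False using False m y ne y0 l2
        by (simp add: star_weight_simps power2_eq_square numeral_2_eq_2)
    next
      case (Suc j)
      have "card (fiber W ?h y) = Suc (Suc 0)" "card (fiber W ?h (h y)) = Suc (Suc j)"
        "card (fiber W ?h (h x)) = Suc (Suc (Suc m))"
        using sz(2)[of y] sz(2)[of "h y"] sz(2)[of "h x"] y0 m l Suc y ne False by auto
      with * False m y y0 l Suc ne show False by (simp add: star_weight_simps power2_eq_square)
    qed
  qed
qed

end

text \<open>A star with more than \<open>k\<close> leaves yields a set \<open>Z\<close> of centres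
  with more than \<open>k\<close> leaves on average, all of them isolated in \<open>W - Z\<close>.
  For the isolation no leaf of \<open>Z\<close> may see another leaf, which
  \<open>leaf_neighbours\<close> provides only from three leaves on. For \<open>k = 2\<close> a
  centre with two leaves must therefore first be enlarged by a transfer that keeps the cost.\<close>

lemma star_partition:
  assumes fin: "finite W" and loopfree: "\<And>v. {v} \<notin> E" and "k \<ge> 2"
    and iso: "\<And>X. X \<subseteq> W \<Longrightarrow> card (isol E (W - X)) \<le> k * card X"
  obtains h where "star_map E W h"
    "\<And>c. c \<in> W \<Longrightarrow> h c = c \<Longrightarrow> 2 \<le> card (fiber W h c) \<and> card (fiber W h c) \<le> k + 1"
proof -
  have "star_map E W id" by (simp add: star_map_def)
  then have "\<exists>h. star_map E W h \<and> (\<forall>h'. star_map E W h' \<longrightarrow> star_cost W h \<le> star_cost W h')"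
    by (rule ex_has_least_nat[of "star_map E W" _ "star_cost W"])
  then obtain h where h: "star_map E W h" "\<And>h'. star_map E W h' \<Longrightarrow> star_cost W h \<le> star_cost W h'"
    by auto
  interpret min_star_map E W h
    using fin loopfree h by unfold_locales
  define X where "X = {v \<in> W. h v \<noteq> v}"
  define C where "C = {c \<in> W. h c = c}"
  define N where "N v = {c \<in> C. {c, v} \<in> E}" for v
  have finX: "finite X" "finite C" using fin by (auto simp: X_def C_def)
  have size: "card (fiber W g c) = Suc (card (fiber X g c))"
    if "c \<in> C" "\<And>v. v \<in> C \<Longrightarrow> g v = v" for g c
  proof -
    have "fiber W g c = insert c (fiber X g c)"
      using that by (auto simp: fiber_def X_def C_def)
    moreover have "c \<notin> fiber X g c" using that by (auto simp: fiber_def X_def C_def)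
    ultimately show ?thesis using finX by (simp add: fiber_def)
  qed
  have hC: "h v = v" if "v \<in> C" for v using that by (simp add: C_def)
  have hN: "h v \<in> N v" if "v \<in> X" for v
    using that h(1) by (auto simp: X_def N_def C_def star_map_def insert_commute)
  have two: "2 \<le> card (fiber W h c)" if c: "c \<in> C" for c
  proof -
    have "isol E W = {}" using iso[of "{}"] fin by (simp add: isol_def)
    then obtain y where "y \<in> W" "{y, c} \<in> E" using c by (auto simp: isol_def C_def)
    then have "card (fiber W h c) \<noteq> 1" using no_trivial_star[of c y] c by (auto simp: C_def)
    moreover have "1 \<le> card (fiber W h c)" using size[OF c hC] by simp
    ultimately show ?thesis by linarith
  qed
  let ?r = "shift_step X N h"
  have "card (fiber X h s) \<le> k" if s: "s \<in> C" for s
  proof (rule ccontr)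
    assume big: "\<not> ?thesis"
    define Z where "Z = {c. ?r\<^sup>*\<^sup>* c s}"
    have ZC: "Z \<subseteq> C"
    proof
      fix c assume "c \<in> Z"
      then have "?r\<^sup>*\<^sup>* c s" by (simp add: Z_def)
      from rtranclp_closed[OF this s] show "c \<in> C" by (auto simp: shift_step_def N_def)
    qed
    have key: "k \<le> card (fiber X h a) \<and> (\<forall>x\<in>X. h x = a \<longrightarrow> (\<forall>y\<in>W. {y, x} \<in> E \<longrightarrow> y \<in> C))"
      if a: "a \<in> Z" for a
    proof -
      have aC: "a \<in> C" using ZC a by auto
      have direct: ?thesis if "3 \<le> card (fiber X h a)" "k \<le> card (fiber X h a)"
      proof -
        have "4 \<le> card (fiber W h a)" using size[OF aC hC] that by simp
        then show ?thesis using leaf_neighbours that by (auto simp: X_def C_def)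
      qed
      show ?thesis
      proof (cases "a = s \<or> k < card (fiber X h a)")
        case True
        then show ?thesis using direct big \<open>k \<ge> 2\<close> by auto
      next
        case False
        then obtain g where g: "\<forall>x\<in>X. g x \<in> N x" "\<forall>x\<in>X. h x = a \<longrightarrow> g x = a"
          "\<And>c. int (card (fiber X g c)) =
             int (card (fiber X h c)) + of_bool (c = a) - of_bool (c = s)"
          using path_shift[where a = a and b = s and f = h and N = N, OF finX(1) hN] a by (auto simp: Z_def)
        define h' where "h' v = (if v \<in> X then g v else h v)" for v
        have h'X: "fiber X h' c = fiber X g c" for c by (auto simp: fiber_def h'_def)
        have h'C: "h' v = v" if "v \<in> C" for v using that by (auto simp: h'_def C_def X_def)
        have map': "star_map E W h'"
          unfolding star_map_def
        proof
          fix v assume "v \<in> W"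
          show "h' v \<in> W \<and> h' (h' v) = h' v \<and> (h' v \<noteq> v \<longrightarrow> {v, h' v} \<in> E)"
          proof (cases "v \<in> X")
            case True
            then have "g v \<in> C" "{v, g v} \<in> E" using g(1) by (auto simp: N_def insert_commute)
            then show ?thesis using True h'C by (auto simp: h'_def C_def)
          next
            case False
            then have "v \<in> C" using \<open>v \<in> W\<close> by (auto simp: C_def X_def)
            then show ?thesis using h'C \<open>v \<in> W\<close> by auto
          qed
        qed
        obtain L l where Ll: "card (fiber W h s) = Suc (Suc (Suc L))" "card (fiber W h a) = Suc (Suc l)"
          using two[OF aC] size[OF s hC] big \<open>k \<ge> 2\<close>
          by (metis One_nat_def Suc_le_D Suc_le_mono not_less_eq_eq numeral_2_eq_2 le_Suc_eq)
        have "card (fiber W h' c) = card (fiber W h c)" if "c \<in> W - {a, s}" for c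
        proof (cases "c \<in> C")
          case True
          then show ?thesis using g(3)[of c] that by (simp add: size hC h'C h'X)
        next
          case False
          then have "h c \<noteq> c" using that by (auto simp: C_def)
          moreover have "h' c \<noteq> c" using False that g(1) by (auto simp: h'_def C_def X_def N_def)
          ultimately have "fiber W h c = {}" "fiber W h' c = {}"
            using map map' by (auto simp: star_map_def fiber_def)
          then show ?thesis by simp
        qed
        moreover have sz': "card (fiber W h' s) = Suc (Suc L)" "card (fiber W h' a) = Suc (Suc (Suc l))"
          using g(3)[of s] g(3)[of a] Ll False size[OF s hC] size[OF aC hC]
            size[OF s h'C] size[OF aC h'C] by (auto simp: h'X)
        ultimately have change: "star_cost W h' + ((Suc l)\<^sup>2 + (Suc (Suc L))\<^sup>2) = star_cost W h + ((Suc (Suc l))\<^sup>2 + (Suc L)\<^sup>2)"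
          using star_cost_change[OF fin, of "{a, s}" h' h] aC s False Ll
          by (simp add: C_def star_weight_simps)
        then have "L \<le> l" using h(2)[OF map'] by (simp add: power2_eq_square)
        have loads: "card (fiber X h s) = Suc (Suc L)" "card (fiber X h a) = Suc l"
          using Ll size[OF s hC] size[OF aC hC] by auto
        then have lk: "k \<le> Suc l" using big \<open>L \<le> l\<close> by simp
        then have eq: "L = l" "k = Suc l" using False loads big \<open>L \<le> l\<close> by auto
        then have "star_cost W h' = star_cost W h" using change by simp
        \<comment> \<open>Here \<open>s\<close> has \<open>k + 1\<close> leaves and \<open>a\<close>
          has \<open>k\<close>, so the transfer only exchanges two sizes. The new map is again
          optimal, and \<open>a\<close> now has at least three leaves.\<close>
        then interpret h': min_star_map E W h'
          using fin loopfree h map' by unfold_locales auto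
        \<comment> \<open>The old leaves of \<open>a\<close> are still its leaves under
          \<open>h'\<close>, and both maps have the same centres.\<close>
        have "y \<in> C" if "x \<in> X" "h x = a" "y \<in> W" "{y, x} \<in> E" for x y
        proof -
          have x: "x \<in> W" "h' x = a" "a \<noteq> x" using g(2) that aC by (auto simp: h'_def X_def C_def)
          have "card (fiber W h' a) \<ge> 4" using sz' eq \<open>k \<ge> 2\<close> by simp
          then have "h' y = y" using h'.leaf_neighbours[of x y] x that by simp
          then show "y \<in> C"
            using that g(1) by (auto simp: h'_def C_def X_def N_def split: if_splits)
        qed
        then show ?thesis unfolding loads using lk by blast
      qed
    qed
    have finZ: "finite Z" using finX(2) ZC finite_subset by blast
    have "k * card Z < card {x \<in> X. h x \<in> Z}"
      using key big finX finZ by (intro sum_card_fiber_lower[of X Z s]) (auto simp: Z_def)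
    \<comment> \<open>A leaf attached to \<open>Z\<close> sees only centres, and every centre it
      sees could take it over and so belongs to \<open>Z\<close>.\<close>
    also have "\<dots> \<le> card (isol E (W - Z))"
    proof (intro card_mono subsetI)
      fix x assume x: "x \<in> {x \<in> X. h x \<in> Z}"
      have "{u, x} \<notin> E" if "u \<in> W - Z" for u
      proof
        assume "{u, x} \<in> E"
        then have "u \<in> C" using key x that by blast
        then have "?r u (h x)" using x \<open>{u, x} \<in> E\<close> by (auto simp: shift_step_def N_def)
        then have "u \<in> Z" using x by (auto simp: Z_def intro: converse_rtranclp_into_rtranclp)
        then show False using that by simp
      qed
      moreover have "x \<in> W - Z" using x ZC by (auto simp: X_def C_def)
      ultimately show "x \<in> isol E (W - Z)" by (auto simp: isol_def)
    qed (use fin in \<open>simp add: isol_def\<close>)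
    also have "\<dots> \<le> k * card Z" using ZC by (intro iso) (auto simp: C_def)
    finally show False by simp
  qed
  then show thesis using that[OF h(1)] two size[OF _ hC] by (force simp: C_def)
qed

section \<open>Splitting tokens in two\<close>

text \<open>The tokens of \<open>b\<close> are \<open>(b, True)\<close> and \<open>(b, False)\<close>; \<open>f\<close> assigns each token to its receiver.\<close>

definition ends :: "('b \<times> bool \<Rightarrow> 's) \<Rightarrow> 'b \<Rightarrow> 's set" where
  "ends f b = {f (b, True), f (b, False)}"

definition load :: "'b set \<Rightarrow> ('b \<times> bool \<Rightarrow> 's) \<Rightarrow> 's \<Rightarrow> nat" where
  "load I f s = card (fiber (I \<times> UNIV) f s)"

definition split_at :: "('b \<times> bool \<Rightarrow> 's) \<Rightarrow> 'b \<Rightarrow> bool" where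
  "split_at f b \<longleftrightarrow> f (b, True) \<noteq> f (b, False)"

text \<open>Adjacency in the multigraph on the receivers whose edges are the vertices of
  \<open>I\<close>. An unsplit vertex is a loop and connects nothing.\<close>

definition link :: "'b set \<Rightarrow> ('b \<times> bool \<Rightarrow> 's) \<Rightarrow> 's \<Rightarrow> 's \<Rightarrow> bool" where
  "link I f u v \<longleftrightarrow> (\<exists>b\<in>I. u \<in> ends f b \<and> v \<in> ends f b)"

lemma in_ends: "f (b, j) \<in> ends f b"
  by (cases j) (auto simp: ends_def)

lemma in_endsE:
  assumes "s \<in> ends f b" obtains j where "f (b, j) = s"
  using assms by (auto simp: ends_def)

lemma link_sym: "(link I f)\<^sup>*\<^sup>* u v \<Longrightarrow> (link I f)\<^sup>*\<^sup>* v u"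
  by (rule sympD[OF symp_rtranclp]) (auto simp: symp_def link_def)

text \<open>Shifting along links is shifting with the permitted receivers of each vertex cut down to
  its current ends; hence it never splits a vertex.\<close>

lemma link_shift_step: "link I f = shift_step (I \<times> UNIV) (\<lambda>x. ends f (fst x)) f"
proof (intro ext)
  fix u v
  show "link I f u v = shift_step (I \<times> UNIV) (\<lambda>x. ends f (fst x)) f u v"
    unfolding link_def shift_step_def
    by (auto elim!: in_endsE simp: in_ends) (metis in_ends)+
qed

lemma load_sum:
  assumes "finite I"
  shows "load I f s = (\<Sum>b\<in>I. of_bool (f (b, True) = s) + of_bool (f (b, False) = s))"
proof -
  have "card {j. f (b, j) = s} = of_bool (f (b, True) = s) + of_bool (f (b, False) = s)" for b
  proof -
    have "card {j. f (b, j) = s} = (\<Sum>j\<in>UNIV. of_bool (f (b, j) = s))" by simp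
    then show ?thesis unfolding UNIV_bool by (simp del: sum_of_bool_eq)
  qed
  moreover have "fiber (I \<times> UNIV) f s = Sigma I (\<lambda>b. {j. f (b, j) = s})"
    by (auto simp: fiber_def)
  ultimately show ?thesis using assms by (simp add: load_def)
qed

text \<open>If all split vertices stayed split, their tokens could at most be swapped, while tokens
  of unsplit vertices cannot move. Then no load would change, but \<open>a\<close> gains a
  token.\<close>

lemma link_shift:
  assumes "finite I" "(link I f)\<^sup>*\<^sup>* a c" "a \<noteq> c"
  obtains g where "\<And>b j. b \<in> I \<Longrightarrow> g (b, j) \<in> ends f b"
    "\<And>s. int (load I g s) = int (load I f s) + of_bool (s = a) - of_bool (s = c)"
    "\<exists>b\<in>I. split_at f b \<and> \<not> split_at g b"
proof -
  have "\<exists>g. (\<forall>x\<in>I \<times> UNIV. g x \<in> ends f (fst x)) \<and> (\<forall>x\<in>I \<times> UNIV. f x = a \<longrightarrow> g x = a) \<and>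
    (\<forall>s. int (card (fiber (I \<times> UNIV) g s)) =
      int (card (fiber (I \<times> UNIV) f s)) + of_bool (s = a) - of_bool (s = c))"
    using assms by (intro path_shift) (auto simp: link_shift_step in_ends)
  then obtain g where g0: "\<forall>x\<in>I \<times> (UNIV :: bool set). g x \<in> ends f (fst x)"
    "\<forall>s. int (card (fiber (I \<times> UNIV) g s)) =
      int (card (fiber (I \<times> UNIV) f s)) + of_bool (s = a) - of_bool (s = c)" by blast
  have g1: "g (b, j) \<in> ends f b" if "b \<in> I" for b j
    using bspec[OF g0(1), of "(b, j)"] that by simp
  have g2: "int (load I g s) = int (load I f s) + of_bool (s = a) - of_bool (s = c)" for s
    using spec[OF g0(2), of s] unfolding load_def .
  have "\<exists>b\<in>I. split_at f b \<and> \<not> split_at g b"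
  proof (rule ccontr)
    assume *: "\<not> ?thesis"
    have "load I g a = load I f a"
      unfolding load_sum[OF assms(1)]
    proof (rule sum.cong)
      fix b assume b: "b \<in> I"
      have "split_at f b \<longrightarrow> split_at g b" using * b by blast
      then have "g (b, True) = f (b, True) \<and> g (b, False) = f (b, False) \<or>
          g (b, True) = f (b, False) \<and> g (b, False) = f (b, True)"
        using g1[OF b, of True] g1[OF b, of False] unfolding ends_def split_at_def by (metis empty_iff insert_iff)
      then show "of_bool (g (b, True) = a) + of_bool (g (b, False) = a) =
        (of_bool (f (b, True) = a) + of_bool (f (b, False) = a) :: nat)"
        by (elim disjE) simp_all
    qed simp
    then show False using g2[of a] assms(3) by simp
  qed
  then show thesis using that[of g] g1 g2 by blast
qed

section \<open>Assignments with the fewest split vertices\<close>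

lemma load_remove:
  assumes "finite I" "b \<in> I"
  shows "load I f s = load (I - {b}) f s + (of_bool (f (b, True) = s) + of_bool (f (b, False) = s))"
  using assms by (simp add: load_sum sum.remove[of I b])

lemma load_cong:
  assumes "\<And>b j. b \<in> I \<Longrightarrow> f (b, j) = g (b, j)"
  shows "load I f s = load I g s"
  using assms by (auto simp: load_def fiber_def intro: arg_cong[of _ _ card])

lemma link_mono:
  assumes "(link I f)\<^sup>*\<^sup>* u v" "I \<subseteq> J"
  shows "(link J f)\<^sup>*\<^sup>* u v"
proof -
  have "link I f \<le> link J f" using assms(2) by (auto simp: link_def le_fun_def)
  then show ?thesis using rtranclp_mono assms(1) by blast
qed

text \<open>With the number of split vertices minimal, no rearrangement within the current ends can
  keep the loads permitted and unsplit a vertex. A cycle of links would allow one, and so would a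
  link component of a split vertex in which both loads occur.\<close>

lemma forest_assignment:
  assumes fin: "finite I" "finite S"
    and N: "\<And>b. b \<in> I \<Longrightarrow> N b \<subseteq> S" "\<And>b. b \<in> I \<Longrightarrow> N b \<noteq> {}"
    and upper: "\<And>Y. Y \<subseteq> S \<Longrightarrow> 2 * card {b \<in> I. N b \<subseteq> Y} \<le> (2 * k + 1) * card Y"
    and lower: "\<And>Y. Y \<subseteq> S \<Longrightarrow> k * card Y \<le> card {b \<in> I. N b \<inter> Y \<noteq> {}}"
  obtains f where "\<And>b j. b \<in> I \<Longrightarrow> f (b, j) \<in> N b"
    "\<And>s. s \<in> S \<Longrightarrow> load I f s \<in> {2 * k, 2 * k + 1}"
    "\<And>b. b \<in> I \<Longrightarrow> split_at f b \<Longrightarrow> \<not> (link (I - {b}) f)\<^sup>*\<^sup>* (f (b, True)) (f (b, False))"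
    "\<And>b s. b \<in> I \<Longrightarrow> split_at f b \<Longrightarrow> s \<in> ends f b \<Longrightarrow> load I f s = 2 * k + 1"
proof -
  have tok: "card {x \<in> I \<times> (UNIV :: bool set). P (fst x)} = 2 * card {b \<in> I. P b}" for P
  proof -
    have "{x \<in> I \<times> (UNIV :: bool set). P (fst x)} = {b \<in> I. P b} \<times> UNIV" by auto
    then show ?thesis by (simp add: card_cartesian_product)
  qed
  let ?V = "\<lambda>f. (\<forall>b\<in>I. \<forall>j. f (b, j) \<in> N b) \<and> (\<forall>s\<in>S. load I f s \<in> {2 * k, 2 * k + 1})"
  obtain f0 where f0: "\<And>x. x \<in> I \<times> (UNIV :: bool set) \<Longrightarrow> f0 x \<in> N (fst x)"
    "\<And>s. s \<in> S \<Longrightarrow> 2 * k \<le> card (fiber (I \<times> UNIV) f0 s)"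
    "\<And>s. s \<in> S \<Longrightarrow> card (fiber (I \<times> UNIV) f0 s) \<le> 2 * k + 1"
  proof (rule balanced_assignment[of "I \<times> (UNIV :: bool set)" S "\<lambda>x. N (fst x)" "2 * k + 1" "2 * k"])
    show "card {x \<in> I \<times> (UNIV :: bool set). N (fst x) \<subseteq> Y} \<le> (2 * k + 1) * card Y" if "Y \<subseteq> S" for Y
      using upper[OF that] by (simp add: tok[of "\<lambda>b. N b \<subseteq> Y"])
    show "2 * k * card Y \<le> card {x \<in> I \<times> (UNIV :: bool set). N (fst x) \<inter> Y \<noteq> {}}" if "Y \<subseteq> S" for Y
      using lower[OF that] by (simp add: tok[of "\<lambda>b. N b \<inter> Y \<noteq> {}"])
    show "N (fst x) \<subseteq> S" "N (fst x) \<noteq> {}" if "x \<in> I \<times> (UNIV :: bool set)" for x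
      using N[of "fst x"] that by (simp_all add: mem_Times_iff)
  qed (use fin in auto)
  have "load I f0 s \<in> {2 * k, 2 * k + 1}" if "s \<in> S" for s
    using f0(2,3)[OF that] unfolding load_def by auto
  then have "?V f0" using f0(1) by auto
  then have "\<exists>f. ?V f \<and> (\<forall>g. ?V g \<longrightarrow> card {b \<in> I. split_at f b} \<le> card {b \<in> I. split_at g b})"
    by (rule ex_has_least_nat[of ?V _ "\<lambda>f. card {b \<in> I. split_at f b}"])
  then obtain f where f: "?V f" and
    min: "\<And>g. ?V g \<Longrightarrow> card {b \<in> I. split_at f b} \<le> card {b \<in> I. split_at g b}" by auto
  have minimal: "\<not> (\<exists>b\<in>I. split_at f b \<and> \<not> split_at g b)"
    if "\<And>b j. b \<in> I \<Longrightarrow> g (b, j) \<in> ends f b" "\<And>s. s \<in> S \<Longrightarrow> load I g s \<in> {2 * k, 2 * k + 1}" for g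
  proof
    assume *: "\<exists>b\<in>I. split_at f b \<and> \<not> split_at g b"
    have "split_at f b" if "b \<in> I" "split_at g b" for b
      using that(2) \<open>\<And>b j. b \<in> I \<Longrightarrow> g (b, j) \<in> ends f b\<close>[OF that(1)]
      by (auto simp: split_at_def ends_def)
    with * have "{b \<in> I. split_at g b} \<subset> {b \<in> I. split_at f b}" by auto
    then have "card {b \<in> I. split_at g b} < card {b \<in> I. split_at f b}"
      using fin by (intro psubset_card_mono) auto
    moreover have "g (b, j) \<in> N b" if "b \<in> I" for b j
      using \<open>\<And>b j. b \<in> I \<Longrightarrow> g (b, j) \<in> ends f b\<close>[OF that, of j] f that by (auto simp: ends_def)
    ultimately show False using min[of g] that(2) by fastforce
  qed
  have bridge: "\<not> (link (I - {b}) f)\<^sup>*\<^sup>* (f (b, True)) (f (b, False))"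
    if b: "b \<in> I" "split_at f b" for b
  proof
    assume path: "(link (I - {b}) f)\<^sup>*\<^sup>* (f (b, True)) (f (b, False))"
    define a c where "a = f (b, True)" and "c = f (b, False)"
    have "a \<noteq> c" using b by (simp add: a_def c_def split_at_def)
    have "(link (I - {b}) f)\<^sup>*\<^sup>* c a" using link_sym[OF path] by (simp add: a_def c_def)
    moreover have "finite (I - {b})" using fin by simp
    ultimately obtain g where g: "\<And>b' j. b' \<in> I - {b} \<Longrightarrow> g (b', j) \<in> ends f b'"
      "\<And>s. int (load (I - {b}) g s) = int (load (I - {b}) f s) + of_bool (s = c) - of_bool (s = a)"
      using link_shift[of "I - {b}" f c a] \<open>a \<noteq> c\<close> by metis
    \<comment> \<open>Both tokens of \<open>b\<close> go to \<open>a\<close>, and the path avoiding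
      \<open>b\<close> carries the surplus back to \<open>c\<close>: all loads are as before, but
      \<open>b\<close> is no longer split.\<close>
    define g' where "g' = g((b, True) := a, (b, False) := a)"
    have "load (I - {b}) g' s = load (I - {b}) g s" for s
      by (rule load_cong) (auto simp: g'_def)
    then have "int (load I g' s) = int (load I f s)" for s
      using load_remove[OF fin(1) b(1), of g' s] load_remove[OF fin(1) b(1), of f s] g(2)[of s] \<open>a \<noteq> c\<close>
      by (auto simp: g'_def a_def c_def)
    then have "load I g' s \<in> {2 * k, 2 * k + 1}" if "s \<in> S" for s using f that by auto
    moreover have "g' (b', j) \<in> ends f b'" if "b' \<in> I" for b' j
      using g(1)[of b' j] that by (cases j) (auto simp: g'_def a_def ends_def)
    ultimately have "\<not> (\<exists>b\<in>I. split_at f b \<and> \<not> split_at g' b)" by (intro minimal)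
    moreover have "\<not> split_at g' b" by (simp add: g'_def split_at_def)
    ultimately show False using b by blast
  qed
  have tight: "load I f s = 2 * k + 1" if b: "b \<in> I" "split_at f b" "s \<in> ends f b" for b s
  proof (rule ccontr)
    assume ns: "load I f s \<noteq> 2 * k + 1"
    have inS: "c \<in> S" if "link I f u c" for u c
      using that f N(1) by (auto simp: link_def ends_def)
    \<comment> \<open>A linked receiver of load \<open>2 * k + 1\<close> could pass a token to
      \<open>s\<close>. This exchanges the two loads and unsplits a vertex.\<close>
    have even_load: "load I f c = 2 * k" if path: "(link I f)\<^sup>*\<^sup>* s c" for c
    proof (rule ccontr)
      assume nc: "load I f c \<noteq> 2 * k"
      have sS: "s \<in> S" using b f N(1) by (auto simp: ends_def)
      then have ls: "load I f s = 2 * k" using f ns by auto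
      have "s \<noteq> c" using ls nc by auto
      then have "c \<in> S" using path inS by (auto elim: rtranclp.cases)
      then have lc: "load I f c = 2 * k + 1" using f nc by auto
      obtain g where g: "\<And>b j. b \<in> I \<Longrightarrow> g (b, j) \<in> ends f b"
        "\<And>u. int (load I g u) = int (load I f u) + of_bool (u = s) - of_bool (u = c)"
        "\<exists>b\<in>I. split_at f b \<and> \<not> split_at g b"
        using link_shift[OF fin(1) path \<open>s \<noteq> c\<close>] by metis
      have "load I g u \<in> {2 * k, 2 * k + 1}" if "u \<in> S" for u
        using g(2)[of u] f that ls lc \<open>s \<noteq> c\<close> by (cases "u = s"; cases "u = c") auto
      then show False using minimal[of g] g by blast
    qed
    \<comment> \<open>Parity: loads in the component \<open>Z\<close> of \<open>s\<close> without \<open>b\<close> are even, but \<open>Z\<close> receives one token of \<open>b\<close>.\<close>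
    define Z where "Z = {c. (link (I - {b}) f)\<^sup>*\<^sup>* s c}"
    obtain i where i: "f (b, i) = s" using b(3) by (rule in_endsE)
    have other: "f (b, \<not> i) \<notin> Z"
    proof
      assume "f (b, \<not> i) \<in> Z"
      then show False
        using bridge[OF b(1,2)] i link_sym[of "I - {b}" f s] by (cases i) (auto simp: Z_def)
    qed
    have "Z \<subseteq> insert s S"
    proof
      fix c assume "c \<in> Z"
      then have "(link I f)\<^sup>*\<^sup>* s c" using link_mono[of "I - {b}" f s c I] by (auto simp: Z_def)
      then show "c \<in> insert s S" using inS by (auto elim: rtranclp.cases)
    qed
    then have finZ: "finite Z" using fin(2) finite_subset by blast
    have "card {x \<in> I \<times> UNIV. f x \<in> Z} = (\<Sum>c\<in>Z. load I f c)"
      unfolding load_def using fin finZ by (subst sum_card_fiber) auto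
    also have "\<dots> = (\<Sum>c\<in>Z. 2 * k)"
      using even_load link_mono[of "I - {b}" f s _ I] by (intro sum.cong) (auto simp: Z_def)
    finally have "even (card {x \<in> I \<times> UNIV. f x \<in> Z})" by simp
    moreover have "{x \<in> I \<times> UNIV. f x \<in> Z} =
        insert (b, i) ({b' \<in> I - {b}. f (b', True) \<in> Z} \<times> UNIV)"
    proof -
      have "f (b', j) \<in> Z \<longleftrightarrow> f (b', True) \<in> Z" if "b' \<in> I - {b}" for b' j
      proof -
        have "link (I - {b}) f (f (b', j)) (f (b', True))" "link (I - {b}) f (f (b', True)) (f (b', j))"
          using that by (auto simp: link_def intro: in_ends)
        then show ?thesis by (auto simp: Z_def intro: rtranclp.rtrancl_into_rtrancl)
      qed
      moreover have "s \<in> Z" by (simp add: Z_def)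
      moreover have "f (b, j) \<in> Z \<longleftrightarrow> j = i" for j
        using other i \<open>s \<in> Z\<close> by (cases "j = i") auto
      ultimately show ?thesis using b(1) i by auto
    qed
    moreover have "card (insert (b, i) ({b' \<in> I - {b}. f (b', True) \<in> Z} \<times> (UNIV :: bool set)))
        = Suc (2 * card {b' \<in> I - {b}. f (b', True) \<in> Z})"
      using fin by (subst card_insert_disjoint) (auto simp: card_cartesian_product)
    ultimately show False by simp
  qed
  show thesis
  proof (rule that[of f])
    show "f (b, j) \<in> N b" if "b \<in> I" for b j using f that by blast
    show "load I f s \<in> {2 * k, 2 * k + 1}" if "s \<in> S" for s using f that by blast
  qed (fact bridge, fact tight)
qed

section \<open>Factors from blocks\<close>

lemma isomorphic_refl: "isomorphic G G"
  unfolding isomorphic_def by (intro exI[of _ id]) auto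

lemma isomorphic_sym:
  assumes "isomorphic G H" shows "isomorphic H G"
proof -
  obtain f where f: "bij_betw f (verts G) (verts H)"
    "\<And>u v. u \<in> verts G \<Longrightarrow> v \<in> verts G \<Longrightarrow> {u, v} \<in> edges G \<longleftrightarrow> {f u, f v} \<in> edges H"
    using assms by (auto simp: isomorphic_def)
  let ?g = "inv_into (verts G) f"
  have "?g u \<in> verts G \<and> f (?g u) = u" if "u \<in> verts H" for u
    using f(1) that by (metis bij_betw_def f_inv_into_f inv_into_into)
  then show ?thesis
    unfolding isomorphic_def using bij_betw_inv_into[OF f(1)] f(2)
    by (intro exI[of _ ?g]) auto
qed

lemma isomorphic_trans:
  assumes "isomorphic G H" "isomorphic H K" shows "isomorphic G K"
proof -
  obtain f where f: "bij_betw f (verts G) (verts H)"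
    "\<And>u v. u \<in> verts G \<Longrightarrow> v \<in> verts G \<Longrightarrow> {u, v} \<in> edges G \<longleftrightarrow> {f u, f v} \<in> edges H"
    using assms(1) by (auto simp: isomorphic_def)
  obtain g where g: "bij_betw g (verts H) (verts K)"
    "\<And>u v. u \<in> verts H \<Longrightarrow> v \<in> verts H \<Longrightarrow> {u, v} \<in> edges H \<longleftrightarrow> {g u, g v} \<in> edges K"
    using assms(2) by (auto simp: isomorphic_def)
  show ?thesis
    unfolding isomorphic_def
    using bij_betw_trans[OF f(1) g(1)] f g bij_betw_apply[OF f(1)]
    by (intro exI[of _ "g \<circ> f"]) auto
qed

lemma reachable_sym: "reachable G u v \<Longrightarrow> reachable G v u"
  unfolding reachable_def
  by (rule sympD[OF symp_rtranclp]) (auto simp: symp_def insert_commute)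

lemma reachable_trans: "reachable G u v \<Longrightarrow> reachable G v w \<Longrightarrow> reachable G u w"
  unfolding reachable_def by auto

lemma connected_graphI:
  assumes "c \<in> verts G" "\<And>v. v \<in> verts G \<Longrightarrow> reachable G c v"
  shows "connected_graph G"
  unfolding connected_graph_def
proof (intro conjI ballI)
  show "verts G \<noteq> {}" using assms(1) by blast
  show "reachable G u v" if "u \<in> verts G" "v \<in> verts G" for u v
    using reachable_trans[OF reachable_sym[OF assms(2)[OF that(1)]] assms(2)[OF that(2)]] .
qed

text \<open>Lets stars and trees be produced independently of each other: connected blocks with
  disjoint vertex sets are the components of their union.\<close>

lemma has_factor_blocks:
  assumes "simple_graph G" and cover: "\<Union> (verts ` \<B>) = verts G"
    and disj: "\<And>A B. A \<in> \<B> \<Longrightarrow> B \<in> \<B> \<Longrightarrow> A \<noteq> B \<Longrightarrow> verts A \<inter> verts B = {}"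
    and sub: "\<And>B. B \<in> \<B> \<Longrightarrow> edges B \<subseteq> edges G"
    and inside: "\<And>B e. B \<in> \<B> \<Longrightarrow> e \<in> edges B \<Longrightarrow> e \<subseteq> verts B"
    and conn: "\<And>B. B \<in> \<B> \<Longrightarrow> connected_graph B"
    and iso: "\<And>B. B \<in> \<B> \<Longrightarrow> \<exists>H\<in>\<H>. isomorphic B H"
  shows "has_factor \<H> G"
proof -
  define F where "F = \<lparr>verts = verts G, edges = \<Union> (edges ` \<B>)\<rparr>"
  have comp: "induced F {u \<in> verts F. reachable F v u} = B" if B: "B \<in> \<B>" "v \<in> verts B" for v B
  proof -
    have "u \<in> verts B" if "reachable F v u" for u
      using that[unfolded reachable_def]
    proof (induction rule: rtranclp_induct)
      case (step y z)
      then obtain A where A: "A \<in> \<B>" "{y, z} \<in> edges A" by (auto simp: F_def)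
      then have "y \<in> verts A" "z \<in> verts A" using inside[of A] by auto
      then show ?case using disj[OF A(1) B(1)] step.IH by blast
    qed (use B in simp)
    moreover have "reachable F v u" if "u \<in> verts B" for u
    proof -
      have "reachable B v u" using conn[OF B(1)] B(2) that by (auto simp: connected_graph_def)
      moreover have "(\<lambda>u v. {u, v} \<in> edges B) \<le> (\<lambda>u v. {u, v} \<in> edges F)"
        using B(1) by (auto simp: F_def)
      ultimately show ?thesis unfolding reachable_def using rtranclp_mono by blast
    qed
    moreover have "verts B \<subseteq> verts G" using cover B(1) by auto
    ultimately have vs: "{u \<in> verts F. reachable F v u} = verts B" by (auto simp: F_def)
    have "e \<in> edges B" if A: "A \<in> \<B>" "e \<in> edges A" "e \<subseteq> verts B" for A e
    proof -
      have "card e = 2" using assms(1) sub[OF A(1)] A(2) by (auto simp: simple_graph_def)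
      then have "e \<noteq> {}" by auto
      then have "A = B" using disj[OF A(1) B(1)] inside[OF A(1,2)] A(3) by blast
      then show ?thesis using A by simp
    qed
    then have "{e \<in> edges F. e \<subseteq> verts B} = edges B"
      using inside[OF B(1)] B(1) by (auto simp: F_def)
    then show ?thesis unfolding vs induced_def by simp
  qed
  have "is_factor \<H> F G"
    unfolding is_factor_def
  proof (intro conjI ballI)
    show "spanning_subgraph F G" using sub by (auto simp: spanning_subgraph_def F_def)
    fix C assume "C \<in> components F"
    then obtain v where v: "v \<in> verts F" "C = induced F {u \<in> verts F. reachable F v u}"
      by (auto simp: components_def)
    then obtain B where "B \<in> \<B>" "v \<in> verts B" using cover by (auto simp: F_def)
    then show "\<exists>H\<in>\<H>. isomorphic C H" using comp v iso by metis
  qed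
  then show ?thesis by (auto simp: has_factor_def)
qed

section \<open>Stars and cycles\<close>

definition star_at :: "'a \<Rightarrow> 'a set \<Rightarrow> 'a graph" where
  "star_at c L = \<lparr>verts = insert c L, edges = {{c, x} | x. x \<in> L}\<rparr>"

lemma star_at_connected: "connected_graph (star_at c L)"
  by (rule connected_graphI[of c]) (auto simp: star_at_def reachable_def)

lemma star_at_isomorphic:
  assumes "finite L" "c \<notin> L" shows "isomorphic (star_at c L) (star (card L))"
proof -
  obtain f where f: "bij_betw f L {1..card L}"
    using ex_bij_betw_nat_finite_1[OF assms(1)] bij_betw_inv by blast
  define g where "g = f(c := 0)"
  have gL: "g x \<in> {1..card L}" if "x \<in> L" for x
    using bij_betw_apply[OF f that] assms(2) that by (auto simp: g_def)
  have "bij_betw g L {1..card L}"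
    using f assms(2) by (subst bij_betw_cong[of _ _ f]) (auto simp: g_def)
  then have "bij_betw g (insert c L) (insert (g c) {1..card L})"
    using assms(2) by (subst notIn_Un_bij_betw3[symmetric, of c L g, simplified]) (auto simp: g_def)
  moreover have "insert (g c) {1..card L} = {0..card L}" by (auto simp: g_def)
  ultimately have bij: "bij_betw g (insert c L) {0..card L}" by simp
  have inj: "inj_on g L" using f assms(2) by (auto simp: g_def bij_betw_def inj_on_def)
  have g0: "g x = 0 \<longleftrightarrow> x = c" if "x \<in> insert c L" for x
    using gL[of x] that by (auto simp: g_def)
  have "{u, v} \<in> edges (star_at c L) \<longleftrightarrow> {g u, g v} \<in> edges (star (card L))"
    if "u \<in> insert c L" "v \<in> insert c L" for u v
  proof -
    have "{u, v} \<in> edges (star_at c L) \<longleftrightarrow> (u = c \<and> v \<in> L) \<or> (v = c \<and> u \<in> L)"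
      by (auto simp: star_at_def doubleton_eq_iff)
    also have "\<dots> \<longleftrightarrow> (g u = 0 \<and> g v \<in> {1..card L}) \<or> (g v = 0 \<and> g u \<in> {1..card L})"
      using that g0[of u] g0[of v] gL[of u] gL[of v] assms(2) by (auto simp: g_def)
    also have "\<dots> \<longleftrightarrow> {g u, g v} \<in> edges (star (card L))"
      by (auto simp: star_def doubleton_eq_iff)
    finally show ?thesis .
  qed
  with bij show ?thesis unfolding isomorphic_def by (intro exI[of _ g]) (auto simp: star_at_def star_def)
qed

text \<open>Replaces cycles given as lists by reachability. The edge between the first two vertices
  is bypassed by the rest of the cycle, so a graph all of whose edges are bridges is
  acyclic.\<close>

lemma cycle_nonbridge:
  assumes "is_cycle G p"
  obtains u v where "{u, v} \<in> edges G" "(\<lambda>x y. {x, y} \<in> edges G - {{u, v}})\<^sup>*\<^sup>* u v"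
proof -
  have len: "3 \<le> length p" and dist: "distinct p"
    and E: "\<And>i. i < length p \<Longrightarrow> {p ! i, p ! (Suc i mod length p)} \<in> edges G"
    using assms by (auto simp: is_cycle_def)
  let ?r = "\<lambda>x y. {x, y} \<in> edges G - {{p ! 1, p ! 0}}"
  have ne: "p ! i \<noteq> p ! 0" "p ! i \<noteq> p ! 1" if "2 \<le> i" "i < length p" for i
    using nth_eq_iff_index_eq[OF dist, of i 0] nth_eq_iff_index_eq[OF dist, of i 1] that len by force+
  have path: "?r\<^sup>*\<^sup>* (p ! 1) (p ! Suc i)" if "Suc i < length p" for i
    using that
  proof (induction i)
    case (Suc i)
    have "{p ! Suc i, p ! Suc (Suc i)} \<in> edges G" using E[of "Suc i"] Suc.prems by simp
    moreover have "{p ! Suc i, p ! Suc (Suc i)} \<noteq> {p ! 1, p ! 0}"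
      using ne[of "Suc (Suc i)"] Suc.prems by (auto simp: doubleton_eq_iff)
    ultimately show ?case using Suc by (auto intro: rtranclp.rtrancl_into_rtrancl)
  qed simp
  define m where "m = length p - 2"
  have m: "Suc (Suc m) = length p" "1 \<le> m" using len by (auto simp: m_def)
  have "{p ! Suc m, p ! 0} \<in> edges G" using E[of "Suc m"] m by simp
  moreover have "{p ! Suc m, p ! 0} \<noteq> {p ! 1, p ! 0}"
    using ne[of "Suc m"] m by (auto simp: doubleton_eq_iff)
  ultimately have "?r\<^sup>*\<^sup>* (p ! 1) (p ! 0)"
    using path[of m] m by (auto intro: rtranclp.rtrancl_into_rtrancl)
  moreover have "{p ! 1, p ! 0} \<in> edges G" using E[of 0] m by (cases "p = []") (auto simp: insert_commute)
  ultimately show thesis using that by blast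
qed

section \<open>The tree of a tight component\<close>

locale tight_component =
  fixes I K :: "'a set" and f :: "'a \<times> bool \<Rightarrow> 'a" and k :: nat and s0 :: 'a
  assumes finite_I: "finite I" and finite_K: "finite K" and disjoint: "I \<inter> K = {}"
    and K_def: "K = {c. (link I f)\<^sup>*\<^sup>* s0 c}"
    and tight: "\<And>c. c \<in> K \<Longrightarrow> load I f c = 2 * k + 1"
    and bridge: "\<And>b. b \<in> I \<Longrightarrow> split_at f b \<Longrightarrow> \<not> (link (I - {b}) f)\<^sup>*\<^sup>* (f (b, True)) (f (b, False))"
    and k2: "2 \<le> k"
begin

text \<open>Testing one token suffices, as the two receivers of \<open>b\<close> are linked. Members
  of \<open>solid\<close> become leaves of \<open>R\<close>; members of \<open>half\<close> become
  core edges of \<open>R\<close> and, in the block, the vertices subdividing them.\<close>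

definition "J = {b \<in> I. f (b, True) \<in> K}"
definition "solid = {b \<in> J. \<not> split_at f b}"
definition "half = {b \<in> J. split_at f b}"
text \<open>All pendant edges of the block are already leaves of \<open>R\<close>, so that \<open>num_new\<close> vanishes.\<close>

definition "R = \<lparr>verts = K \<union> solid, edges = ends f ` half \<union> {{f (b, True), b} | b. b \<in> solid}\<rparr>"
definition "block = \<lparr>verts = K \<union> J, edges = {{b, f (b, j)} | b j. b \<in> J}\<rparr>"
definition "half_deg c = card {b \<in> half. c \<in> ends f b}"
definition "solid_deg c = card {b \<in> solid. f (b, True) = c}"

lemma K_closed: "c \<in> K \<Longrightarrow> link I f c d \<Longrightarrow> d \<in> K"
  by (auto simp: K_def intro: rtranclp.rtrancl_into_rtrancl)

lemma J_ends: "b \<in> J \<Longrightarrow> f (b, j) \<in> K"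
  using K_closed[of "f (b, True)" "f (b, j)"] by (auto simp: J_def link_def intro: in_ends)

lemma ends_sub: "b \<in> J \<Longrightarrow> ends f b \<subseteq> K"
  using J_ends by (auto simp: ends_def)

lemma in_J: "b \<in> I \<Longrightarrow> c \<in> ends f b \<Longrightarrow> c \<in> K \<Longrightarrow> b \<in> J"
  using K_closed[of c "f (b, True)"] by (auto simp: J_def link_def intro: in_ends)

lemma finite_parts: "finite J" "finite solid" "finite half"
  using finite_I by (auto simp: J_def solid_def half_def)

lemma disjoint_parts: "J \<inter> K = {}" "solid \<inter> K = {}" "half \<inter> K = {}" "solid \<inter> half = {}" "J = solid \<union> half"
  using disjoint by (auto simp: J_def solid_def half_def)

lemma solid_ends: "b \<in> solid \<Longrightarrow> ends f b = {f (b, True)}"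
  by (auto simp: solid_def split_at_def ends_def)

lemma solid_K: "b \<in> solid \<Longrightarrow> f (b, True) \<in> K"
  using J_ends by (simp add: solid_def)

lemma s0_K: "s0 \<in> K"
  by (simp add: K_def)

lemma half_card: "b \<in> half \<Longrightarrow> card (ends f b) = 2"
  by (auto simp: half_def split_at_def ends_def)

text \<open>Two split vertices with the same ends would form a cycle of length two, against
  \<open>bridge\<close>. So the core of \<open>R\<close> has no parallel edges.\<close>

lemma inj_ends: "inj_on (ends f) half"
proof (rule inj_onI, rule ccontr)
  fix b b' assume b: "b \<in> half" "b' \<in> half" "ends f b = ends f b'" "b \<noteq> b'"
  then have "link (I - {b}) f (f (b, True)) (f (b, False))"
    by (auto simp: link_def half_def J_def ends_def)
  with bridge[of b] b show False by (auto simp: half_def J_def)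
qed

text \<open>A solid vertex spends both tokens on one receiver, a half vertex only one. This is
  condition (b) with equality, and its parity gives the odd core degrees of (a).\<close>

lemma load_parts:
  assumes "c \<in> K" shows "half_deg c + 2 * solid_deg c = 2 * k + 1"
proof -
  have "load I f c = (\<Sum>b\<in>J. of_bool (f (b, True) = c) + of_bool (f (b, False) = c))"
    unfolding load_sum[OF finite_I]
  proof (rule sum.mono_neutral_right)
    show "\<forall>b\<in>I - J. of_bool (f (b, True) = c) + of_bool (f (b, False) = c) = (0 :: nat)"
      using in_J[of _ c] assms by (auto simp: ends_def)
  qed (use finite_I in \<open>auto simp: J_def\<close>)
  also have "\<dots> = (\<Sum>b\<in>half. of_bool (f (b, True) = c) + of_bool (f (b, False) = c))
      + (\<Sum>b\<in>solid. of_bool (f (b, True) = c) + of_bool (f (b, False) = c))"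
    using finite_parts disjoint_parts by (simp add: sum.union_disjoint Int_commute add.commute)
  also have "(\<Sum>b\<in>half. of_bool (f (b, True) = c) + of_bool (f (b, False) = c)) = (\<Sum>b\<in>half. of_bool (c \<in> ends f b) :: nat)"
    by (rule sum.cong) (auto simp: half_def split_at_def ends_def)
  also have "\<dots> = half_deg c"
    using finite_parts by (simp add: half_deg_def Int_def)
  also have "(\<Sum>b\<in>solid. of_bool (f (b, True) = c) + of_bool (f (b, False) = c)) = (\<Sum>b\<in>solid. 2 * of_bool (f (b, True) = c) :: nat)"
    by (rule sum.cong) (auto simp: solid_def split_at_def)
  also have "\<dots> = 2 * solid_deg c"
    using finite_parts by (simp add: solid_deg_def Int_def sum_distrib_left[symmetric])
  finally show ?thesis using tight[OF assms] by simp
qed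

section \<open>The graph \<open>R\<close> is an admissible tree\<close>

lemma edge_R_cases:
  assumes "e \<in> edges R"
  obtains b where "b \<in> half" "e = ends f b" | b where "b \<in> solid" "e = {f (b, True), b}"
  using assms by (auto simp: R_def)

lemma simple_R: "simple_graph R"
proof -
  have "e \<subseteq> K \<union> solid \<and> card e = 2" if "e \<in> edges R" for e
    using that
  proof (cases rule: edge_R_cases)
    case (1 b)
    then show ?thesis using ends_sub half_card by (auto simp: half_def)
  next
    case (2 b)
    then show ?thesis using solid_K[of b] disjoint_parts(2) by (auto simp: card_insert_if)
  qed
  then show ?thesis using finite_K finite_parts by (auto simp: simple_graph_def R_def)
qed

lemma solid_edge:
  assumes "b \<in> solid" shows "{e \<in> edges R. b \<in> e} = {{f (b, True), b}}"
proof -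
  have "b \<notin> K" using assms disjoint_parts by auto
  then have "b \<notin> ends f b'" if "b' \<in> half" for b' using ends_sub[of b'] that by (auto simp: half_def)
  moreover have "f (b', True) \<noteq> b" if "b' \<in> solid" for b' using solid_K[OF that] \<open>b \<notin> K\<close> by auto
  ultimately show ?thesis using assms by (auto simp: R_def)
qed

lemma degree_R_solid: "b \<in> solid \<Longrightarrow> degree R b = 1"
  by (simp add: degree_def solid_edge)

lemma half_edges_card: "card {e \<in> ends f ` half. c \<in> e} = half_deg c"
proof -
  have "{e \<in> ends f ` half. c \<in> e} = ends f ` {b \<in> half. c \<in> ends f b}" by auto
  moreover have "inj_on (ends f) {b \<in> half. c \<in> ends f b}"
    using inj_ends by (rule inj_on_subset) auto
  ultimately show ?thesis by (simp add: card_image half_deg_def)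
qed

lemma degree_R_K:
  assumes c: "c \<in> K" shows "degree R c = half_deg c + solid_deg c"
proof -
  let ?A = "{e \<in> ends f ` half. c \<in> e}" and ?B = "(\<lambda>b. {c, b}) ` {b \<in> solid. f (b, True) = c}"
  have cs: "c \<notin> solid" using disjoint_parts c by auto
  have "{e \<in> edges R. c \<in> e} = ?A \<union> ?B"
    using cs by (auto simp: R_def)
  moreover have "?A \<inter> ?B = {}"
    using ends_sub disjoint_parts(2) by (fastforce simp: half_def)
  moreover have "card ?B = solid_deg c"
    unfolding solid_deg_def by (rule card_image) (auto simp: inj_on_def doubleton_eq_iff)
  ultimately show ?thesis
    using finite_parts by (simp add: degree_def card_Un_disjoint half_edges_card)
qed

text \<open>No receiver is itself a leaf: a single edge of \<open>R\<close> accounts for at most two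
  tokens, fewer than the load \<open>2 * k + 1\<close>.\<close>

lemma Leaf_R: "Leaf R = solid"
proof -
  have "degree R c \<noteq> 1" if "c \<in> K" for c
    using load_parts[OF that] degree_R_K[OF that] k2 by presburger
  then show ?thesis using degree_R_solid by (auto simp: Leaf_def R_def)
qed

lemma core_R: "core R = \<lparr>verts = K, edges = ends f ` half\<rparr>"
proof -
  have "verts R - Leaf R = K" using Leaf_R disjoint_parts by (auto simp: R_def)
  moreover have "{e \<in> edges R. e \<subseteq> K} = ends f ` half"
    using ends_sub disjoint_parts(2) by (auto simp: R_def half_def)
  ultimately show ?thesis by (simp add: core_def del_verts_def induced_def)
qed

lemma degree_core: "degree (core R) c = half_deg c"
  by (simp add: degree_def core_R half_edges_card)

lemma num_leaves_R:
  assumes c: "c \<in> K" shows "num_leaves R c = solid_deg c"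
proof -
  have "{c, y} \<in> edges R \<longleftrightarrow> f (y, True) = c" if y: "y \<in> solid" for y
  proof -
    have "c \<noteq> y" using c y disjoint_parts by auto
    have "{c, y} \<in> edges R \<longleftrightarrow> {c, y} \<in> {e \<in> edges R. y \<in> e}" by simp
    also have "\<dots> \<longleftrightarrow> {c, y} = {f (y, True), y}" using solid_edge[OF y] by simp
    also have "\<dots> \<longleftrightarrow> f (y, True) = c" using \<open>c \<noteq> y\<close> by (auto simp: doubleton_eq_iff)
    finally show ?thesis .
  qed
  then have "{y \<in> Leaf R. {c, y} \<in> edges R} = {b \<in> solid. f (b, True) = c}" using Leaf_R by auto
  then show ?thesis by (simp add: num_leaves_def solid_deg_def)
qed

lemma connected_R: "connected_graph R"
proof (rule connected_graphI)
  have K: "reachable R s0 c" if "c \<in> K" for c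
    using that[unfolded K_def, simplified]
  proof (induction rule: rtranclp_induct)
    case base
    then show ?case by (simp add: reachable_def)
  next
    case (step y z)
    then obtain b where b: "b \<in> I" "y \<in> ends f b" "z \<in> ends f b" by (auto simp: link_def)
    then have "b \<in> J" using in_J step.hyps(1) by (auto simp: K_def)
    have "reachable R y z"
    proof (cases "y = z")
      case False
      then have "b \<in> half" "{y, z} = ends f b" using b \<open>b \<in> J\<close> by (auto simp: half_def split_at_def ends_def)
      then have "{y, z} \<in> edges R" by (auto simp: R_def)
      then show ?thesis by (auto simp: reachable_def)
    qed (simp add: reachable_def)
    with step.IH show ?case by (rule reachable_trans)
  qed
  show "s0 \<in> verts R" using s0_K by (simp add: R_def)
  fix v assume v: "v \<in> verts R"
  show "reachable R s0 v"
  proof (cases "v \<in> K")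
    case False
    then have "v \<in> solid" using v by (simp add: R_def)
    then have "{f (v, True), v} \<in> edges R" by (auto simp: R_def)
    then have "reachable R (f (v, True)) v" by (auto simp: reachable_def)
    with K[OF solid_K[OF \<open>v \<in> solid\<close>]] show ?thesis by (rule reachable_trans)
  qed (rule K)
qed

text \<open>Every edge is a bridge: a core edge by \<open>bridge\<close>, any other because it is
  the only edge at its leaf.\<close>

lemma tree_R: "tree R"
proof -
  have "\<not> is_cycle R p" for p
  proof
    assume "is_cycle R p"
    then obtain u v where uv: "{u, v} \<in> edges R" and
      path: "(\<lambda>x y. {x, y} \<in> edges R - {{u, v}})\<^sup>*\<^sup>* u v" by (rule cycle_nonbridge)
    have "u \<noteq> v" using uv simple_R by (auto simp: simple_graph_def)
    let ?r = "\<lambda>x y. {x, y} \<in> edges R - {{u, v}}"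
    show False
    proof (cases "{u, v} \<in> ends f ` half")
      case True
      then obtain b where b: "b \<in> half" "{u, v} = ends f b" by auto
      \<comment> \<open>A walk in \<open>R\<close> avoiding the edge of \<open>b\<close> projects to a walk of links avoiding \<open>b\<close> when
        every leaf is collapsed onto its neighbour.\<close>
      define \<pi> where "\<pi> x = (if x \<in> solid then f (x, True) else x)" for x
      have step: "(link (I - {b}) f)\<^sup>*\<^sup>* (\<pi> x) (\<pi> y)" if "?r x y" for x y
      proof (cases "{x, y} \<in> ends f ` half")
        case True
        then obtain b' where b': "b' \<in> half" "{x, y} = ends f b'" by auto
        then have "b' \<noteq> b" using that b by auto
        then have "link (I - {b}) f x y" using b' by (auto simp: link_def half_def J_def)
        moreover have "x \<notin> solid" "y \<notin> solid"
          using b' ends_sub[of b'] disjoint_parts(2) by (auto simp: half_def)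
        ultimately show ?thesis by (auto simp: \<pi>_def)
      next
        case False
        have "{x, y} \<in> edges R" using that by simp
        with False obtain b' where b': "b' \<in> solid" "{x, y} = {f (b', True), b'}"
          by (auto elim: edge_R_cases)
        moreover have "f (b', True) \<notin> solid" using solid_K[OF b'(1)] disjoint_parts(2) by auto
        ultimately have "\<pi> x = \<pi> y" by (auto simp: \<pi>_def doubleton_eq_iff)
        then show ?thesis by simp
      qed
      have "(link (I - {b}) f)\<^sup>*\<^sup>* (\<pi> u) (\<pi> w)" if "?r\<^sup>*\<^sup>* u w" for w
        using that
      proof (induction rule: rtranclp_induct)
        case (step y z)
        then show ?case using \<open>\<And>x y. ?r x y \<Longrightarrow> (link (I - {b}) f)\<^sup>*\<^sup>* (\<pi> x) (\<pi> y)\<close>[of y z] by auto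
      qed simp
      then have "(link (I - {b}) f)\<^sup>*\<^sup>* (\<pi> u) (\<pi> v)" using path .
      moreover have "\<pi> u = u" "\<pi> v = v"
        using b ends_sub[of b] disjoint_parts(2) by (auto simp: half_def \<pi>_def)
      ultimately have *: "(link (I - {b}) f)\<^sup>*\<^sup>* u v" by simp
      have "(u = f (b, True) \<and> v = f (b, False)) \<or> (u = f (b, False) \<and> v = f (b, True))"
        using b(2) by (simp add: ends_def doubleton_eq_iff)
      then have "(link (I - {b}) f)\<^sup>*\<^sup>* (f (b, True)) (f (b, False))"
        using * link_sym[OF *] by auto
      then show False using bridge[of b] b(1) by (auto simp: half_def J_def)
    next
      case False
      then obtain b where b: "b \<in> solid" "{u, v} = {f (b, True), b}" using uv by (auto simp: R_def)
      have "e = {u, v}" if "e \<in> edges R" "b \<in> e" for e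
      proof -
        have "e \<in> {{f (b, True), b}}" unfolding solid_edge[OF b(1), symmetric] using that by simp
        then show ?thesis using b(2) by simp
      qed
      then have nob: "\<not> ?r x b" "\<not> ?r b x" for x by auto
      have "u = b \<or> v = b" using b(2) by (auto simp: doubleton_eq_iff)
      then show False
      proof
        assume "u = b"
        with path \<open>u \<noteq> v\<close> show False using nob(2) by (metis (no_types, lifting) converse_rtranclpE)
      next
        assume "v = b"
        with path \<open>u \<noteq> v\<close> show False using nob(1) by (metis (no_types, lifting) rtranclp.cases)
      qed
    qed
  qed
  then show ?thesis using simple_R connected_R by (simp add: tree_def)
qed

lemma half_deg_odd:
  assumes "c \<in> K" obtains i where "half_deg c = 2 * i + 1" "i + solid_deg c = k"
proof -
  have "odd (half_deg c + 2 * solid_deg c)" unfolding load_parts[OF assms] by simp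
  then have "odd (half_deg c)" by simp
  then obtain i where "half_deg c = 2 * i + 1" by (rule oddE)
  then show thesis using that[of i] load_parts[OF assms] by auto
qed

lemma admissible_R: "admissible k R"
  unfolding admissible_def
proof (intro conjI ballI)
  show "tree R" by (rule tree_R)
  fix x assume "x \<in> verts R - Leaf R"
  then have x: "x \<in> K" using Leaf_R by (auto simp: R_def)
  from half_deg_odd[OF x] obtain i where i: "half_deg x = 2 * i + 1" "i + solid_deg x = k" .
  then show "degree (core R) x \<in> {2 * i + 1 | i. i \<le> k}" by (auto simp: degree_core)
  show "2 * num_leaves R x + degree (core R) x \<le> 2 * k + 1"
    using i by (simp add: degree_core num_leaves_R[OF x])
qed

lemma num_new_R:
  assumes "c \<in> K" shows "num_new k R c = 0"
proof -
  from half_deg_odd[OF assms] obtain i where "half_deg c = 2 * i + 1" "i + solid_deg c = k" .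
  then show ?thesis by (simp add: num_new_def degree_core num_leaves_R[OF assms])
qed

section \<open>The block is a copy of the tree built from \<open>R\<close>\<close>

lemma tree_of_R: "tree_of k R = \<lparr>verts = Orig ` (K \<union> solid) \<union> Mid ` (ends f ` half),
  edges = {{Orig (f (b, True)), Orig b} | b. b \<in> solid} \<union> {{Orig x, Mid (ends f b)} | x b. b \<in> half \<and> x \<in> ends f b}\<rparr>"
proof -
  have 1: "edges R - edges (core R) = {{f (b, True), b} | b. b \<in> solid}"
  proof -
    have "{f (b, True), b} \<noteq> ends f b'" if "b \<in> solid" "b' \<in> half" for b b'
      using ends_sub[of b'] disjoint_parts(2) that by (auto simp: half_def)
    then show ?thesis unfolding core_R by (auto simp: R_def)
  qed
  have 2: "image Orig ` {{f (b, True), b} | b. b \<in> solid} = {{Orig (f (b, True)), Orig b} | b. b \<in> solid}"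
    unfolding setcompr_eq_image image_image by simp
  have 3: "{{Orig x, Mid e} | x e. e \<in> edges (core R) \<and> x \<in> e}
      = {{Orig x, Mid (ends f b)} | x b. b \<in> half \<and> x \<in> ends f b}"
    unfolding core_R by auto
  have 4: "{Pend x i | x i. x \<in> verts (core R) \<and> i < num_new k R x} = {}"
    "{{Orig x, Pend x i} | x i. x \<in> verts (core R) \<and> i < num_new k R x} = {}"
    using num_new_R unfolding core_R by auto
  show ?thesis unfolding tree_of_def 1 2 3 4 by (simp add: core_R) (simp add: R_def)
qed

lemma block_edge: "{u, v} \<in> edges block \<longleftrightarrow> (u \<in> J \<and> v \<in> ends f u) \<or> (v \<in> J \<and> u \<in> ends f v)"
  by (auto simp: block_def doubleton_eq_iff ends_def) (metis (full_types))+

text \<open>A split vertex is adjacent in the block to exactly its two receivers, so it is the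
  vertex that subdivides the corresponding core edge. All other vertices keep their place in
  \<open>R\<close>.\<close>

lemma isomorphic_tree: "isomorphic block (tree_of k R)"
proof -
  define \<phi> where "\<phi> x = (if x \<in> half then Mid (ends f x) else Orig x)" for x
  have "inj_on \<phi> (K \<union> J)"
    using inj_ends by (auto simp: inj_on_def \<phi>_def)
  moreover have "\<phi> ` (K \<union> J) = verts (tree_of k R)"
    using disjoint_parts by (auto simp: tree_of_R \<phi>_def image_iff)
  ultimately have bij: "bij_betw \<phi> (verts block) (verts (tree_of k R))"
    by (simp add: bij_betw_def block_def)
  have OO: "{Orig u, Orig v} \<in> edges (tree_of k R) \<longleftrightarrow> (u \<in> solid \<and> v = f (u, True)) \<or> (v \<in> solid \<and> u = f (v, True))" for u v
    by (auto simp: tree_of_R doubleton_eq_iff)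
  have OM: "{Orig u, Mid (ends f v)} \<in> edges (tree_of k R) \<longleftrightarrow> u \<in> ends f v" if "v \<in> half" for u v
    using that by (auto simp: tree_of_R doubleton_eq_iff)
  have MM: "{Mid u, Mid v} \<notin> edges (tree_of k R)" for u v
    by (auto simp: tree_of_R doubleton_eq_iff)
  have "{u, v} \<in> edges block \<longleftrightarrow> {\<phi> u, \<phi> v} \<in> edges (tree_of k R)"
    if uv: "u \<in> K \<union> J" "v \<in> K \<union> J" for u v
  proof -
    have nh: "x \<notin> ends f y" if "x \<in> J" "y \<in> J" for x y
      using ends_sub[OF that(2)] that disjoint_parts(1) by auto
    have sol: "u \<in> J \<longleftrightarrow> u \<in> solid" if "u \<notin> half" for u using that disjoint_parts(5) by auto
    have hJ: "u \<in> J" if "u \<in> half" for u using that by (simp add: half_def)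
    show ?thesis
    proof (cases "u \<in> half"; cases "v \<in> half")
      assume h: "u \<in> half" "v \<in> half"
      then show ?thesis using nh hJ MM by (simp add: block_edge \<phi>_def)
    next
      assume h: "u \<in> half" "v \<notin> half"
      then show ?thesis using nh[of u v] hJ OM[of u v] by (auto simp: block_edge \<phi>_def insert_commute)
    next
      assume h: "u \<notin> half" "v \<in> half"
      then show ?thesis using nh[of v u] hJ OM[of v u] by (auto simp: block_edge \<phi>_def)
    next
      assume h: "u \<notin> half" "v \<notin> half"
      then show ?thesis using OO sol solid_ends by (auto simp: block_edge \<phi>_def)
    qed
  qed
  then show ?thesis using bij unfolding isomorphic_def by (intro exI[of _ \<phi>]) (auto simp: block_def)
qed

lemma simple_block: "simple_graph block"
proof -
  have "f (b, j) \<noteq> b" if "b \<in> J" for b j using J_ends[OF that, of j] that disjoint_parts(1) by auto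
  then have "b \<noteq> f (b, j)" if "b \<in> J" for b j using that by metis
  then show ?thesis using finite_K finite_parts J_ends
    by (auto simp: simple_graph_def block_def card_insert_if)
qed

lemma connected_block: "connected_graph block"
proof (rule connected_graphI)
  have K: "reachable block s0 c" if "c \<in> K" for c
    using that[unfolded K_def, simplified]
  proof (induction rule: rtranclp_induct)
    case base
    then show ?case by (simp add: reachable_def)
  next
    case (step y z)
    then obtain b where b: "b \<in> I" "y \<in> ends f b" "z \<in> ends f b" by (auto simp: link_def)
    then have "b \<in> J" using in_J step.hyps(1) by (auto simp: K_def)
    then have "{y, b} \<in> edges block" "{b, z} \<in> edges block" using b by (auto simp: block_edge)
    then have "reachable block y b" "reachable block b z" by (auto simp: reachable_def)
    with step.IH show ?case by (blast intro: reachable_trans)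
  qed
  show "s0 \<in> verts block" using s0_K by (simp add: block_def)
  fix v assume v: "v \<in> verts block"
  show "reachable block s0 v"
  proof (cases "v \<in> K")
    case False
    then have "v \<in> J" using v by (simp add: block_def)
    then have "{f (v, True), v} \<in> edges block" by (auto simp: block_edge in_ends)
    then have "reachable block (f (v, True)) v" by (auto simp: reachable_def)
    with K[OF J_ends[OF \<open>v \<in> J\<close>, of True]] show ?thesis by (rule reachable_trans)
  qed (rule K)
qed

end

section \<open>The isolated vertex condition\<close>

text \<open>The formula of \<open>block\<close> outside the locale, so that receivers of either load
  are covered by one family. Linked receivers give the same block.\<close>

definition token_block :: "'a set \<Rightarrow> ('a \<times> bool \<Rightarrow> 'a) \<Rightarrow> 'a \<Rightarrow> 'a graph" where
  "token_block I f s =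
     (let K = {c. (link I f)\<^sup>*\<^sup>* s c}; J = {b \<in> I. f (b, True) \<in> K}
      in \<lparr>verts = K \<union> J, edges = {{b, f (b, j)} | b j. b \<in> J}\<rparr>)"

lemma link_component_sub:
  assumes "\<And>b j. b \<in> I \<Longrightarrow> f (b, j) \<in> S" "s \<in> S"
  shows "{c. (link I f)\<^sup>*\<^sup>* s c} \<subseteq> S"
proof
  fix c assume "c \<in> {c. (link I f)\<^sup>*\<^sup>* s c}"
  then have "(link I f)\<^sup>*\<^sup>* s c" by simp
  then show "c \<in> S"
    by (induction rule: rtranclp_induct) (use assms in \<open>auto simp: link_def ends_def\<close>)
qed

text \<open>No split vertex meets \<open>s\<close>, so no link leaves it, and its
  \<open>2 * k\<close> tokens come in pairs from \<open>k\<close> vertices.\<close>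

lemma token_block_untight:
  assumes fin: "finite I" and "s \<notin> I" and load: "load I f s = 2 * k"
    and nosplit: "\<And>b. b \<in> I \<Longrightarrow> split_at f b \<Longrightarrow> s \<notin> ends f b"
  shows "token_block I f s = star_at s {b \<in> I. f (b, True) = s}" "card {b \<in> I. f (b, True) = s} = k"
proof -
  have eq: "f (b, j) = s" if "b \<in> I" "s \<in> ends f b" for b j
  proof -
    have "f (b, True) = f (b, False)" using nosplit[of b] that by (auto simp: split_at_def)
    then show ?thesis using that(2) by (cases j) (auto simp: ends_def)
  qed
  have "c = s" if "(link I f)\<^sup>*\<^sup>* s c" for c
    using that
  proof (induction rule: rtranclp_induct)
    case (step y z)
    then obtain b where "b \<in> I" "s \<in> ends f b" "z \<in> ends f b" by (auto simp: link_def)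
    then show ?case using eq by (auto elim: in_endsE)
  qed simp
  then have K: "{c. (link I f)\<^sup>*\<^sup>* s c} = {s}" by auto
  have J: "f (b, j) = s" if "b \<in> I" "f (b, True) = s" for b j
    using eq[of b j] that by (simp add: ends_def)
  have "{{b, f (b, j)} | b j. b \<in> I \<and> f (b, True) = s} = {{s, x} | x. x \<in> I \<and> f (x, True) = s}"
  proof (intro set_eqI iffI)
    fix e assume "e \<in> {{b, f (b, j)} | b j. b \<in> I \<and> f (b, True) = s}"
    then obtain b j where b: "e = {b, f (b, j)}" "b \<in> I" "f (b, True) = s" by blast
    then have "e = {s, b}" using J[OF b(2,3), of j] by (simp add: insert_commute)
    then show "e \<in> {{s, x} | x. x \<in> I \<and> f (x, True) = s}" using b by blast
  next
    fix e assume "e \<in> {{s, x} | x. x \<in> I \<and> f (x, True) = s}"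
    then obtain b where b: "e = {s, b}" "b \<in> I" "f (b, True) = s" by blast
    then have "e = {b, f (b, True)}" by (simp add: insert_commute)
    then show "e \<in> {{b, f (b, j)} | b j. b \<in> I \<and> f (b, True) = s}" using b by blast
  qed
  then show "token_block I f s = star_at s {b \<in> I. f (b, True) = s}"
    unfolding token_block_def Let_def K star_at_def by simp
  have "2 * k = (\<Sum>b\<in>I. 2 * of_bool (f (b, True) = s))"
    unfolding load[symmetric] load_sum[OF fin]
  proof (rule sum.cong)
    fix b assume b: "b \<in> I"
    have "f (b, True) = s \<longleftrightarrow> f (b, False) = s"
      using eq[OF b, of True] eq[OF b, of False] by (auto simp: ends_def)
    then show "of_bool (f (b, True) = s) + of_bool (f (b, False) = s) = (2 * of_bool (f (b, True) = s) :: nat)"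
      by simp
  qed simp
  also have "\<dots> = 2 * card {b \<in> I. f (b, True) = s}"
    using fin by (simp add: sum_distrib_left[symmetric] Int_def)
  finally show "card {b \<in> I. f (b, True) = s} = k" by simp
qed

lemma token_block_factor:
  fixes I S :: "nat set"
  assumes fin: "finite I" "finite S" and disj: "I \<inter> S = {}" and "2 \<le> k" and s: "s \<in> S"
    and inS: "\<And>b j. b \<in> I \<Longrightarrow> f (b, j) \<in> S"
    and load: "\<And>s. s \<in> S \<Longrightarrow> load I f s \<in> {2 * k, 2 * k + 1}"
    and bridge: "\<And>b. b \<in> I \<Longrightarrow> split_at f b \<Longrightarrow> \<not> (link (I - {b}) f)\<^sup>*\<^sup>* (f (b, True)) (f (b, False))"
    and tight: "\<And>b s. b \<in> I \<Longrightarrow> split_at f b \<Longrightarrow> s \<in> ends f b \<Longrightarrow> load I f s = 2 * k + 1"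
  shows "connected_graph (token_block I f s)"
    and "\<exists>H \<in> star ` {1..k} \<union> T_family k. isomorphic (token_block I f s) H"
proof -
  have "connected_graph (token_block I f s) \<and>
    (\<exists>H \<in> star ` {1..k} \<union> T_family k. isomorphic (token_block I f s) H)"
  proof (cases "load I f s = 2 * k")
    case True
    have "s \<notin> I" using s disj by auto
    have "s \<notin> ends f b" if "b \<in> I" "split_at f b" for b using tight[OF that, of s] True by auto
    note star = token_block_untight[OF fin(1) \<open>s \<notin> I\<close> True this]
    have "isomorphic (token_block I f s) (star k)"
      using star_at_isomorphic[of "{b \<in> I. f (b, True) = s}" s] fin \<open>s \<notin> I\<close> by (simp add: star)
    then show ?thesis using star_at_connected star(1) \<open>2 \<le> k\<close> by auto
  next
    case False
    define K where "K = {c. (link I f)\<^sup>*\<^sup>* s c}"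
    have KS: "K \<subseteq> S" unfolding K_def using link_component_sub[of I f S s] inS s by blast
    \<comment> \<open>A receiver of any other load meets no split vertex and is linked at most to
      itself, so it could lie in \<open>K\<close> only as \<open>s\<close>.\<close>
    have tK: "load I f c = 2 * k + 1" if "c \<in> K" for c
    proof (rule ccontr)
      assume nt: "load I f c \<noteq> 2 * k + 1"
      have "y = c" if yc: "link I f y c" for y
      proof -
        obtain b where b: "b \<in> I" "y \<in> ends f b" "c \<in> ends f b" using yc by (auto simp: link_def)
        then have "\<not> split_at f b" using tight[of b c] nt by blast
        then show ?thesis using b by (simp add: split_at_def ends_def)
      qed
      have "d = c \<longrightarrow> s = c" if "(link I f)\<^sup>*\<^sup>* s d" for d
        using that
      proof (induction rule: rtranclp_induct)
        case (step y z)
        then show ?case using \<open>\<And>y. link I f y c \<Longrightarrow> y = c\<close>[of y] by blast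
      qed simp
      then have "s = c" using that by (simp add: K_def)
      moreover have "load I f s = 2 * k + 1" using load[OF s] False by auto
      ultimately show False using nt by simp
    qed
    interpret T: tight_component I K f k s
      by unfold_locales (use fin KS disj tK bridge \<open>2 \<le> k\<close> finite_subset in \<open>auto simp: K_def\<close>)
    have block: "T.block = token_block I f s"
      unfolding T.block_def T.J_def token_block_def Let_def K_def[symmetric] by simp
    have "T.block \<in> T_family k"
      using T.simple_block T.admissible_R isomorphic_sym[OF T.isomorphic_tree] by (auto simp: T_family_def)
    then show ?thesis using T.connected_block isomorphic_refl unfolding block by blast
  qed
  then show "connected_graph (token_block I f s)"
    and "\<exists>H \<in> star ` {1..k} \<union> T_family k. isomorphic (token_block I f s) H" by auto
qed

lemma token_block_disjoint:
  assumes "\<And>b j. b \<in> I \<Longrightarrow> f (b, j) \<in> S" "I \<inter> S = {}" "s \<in> S" "s' \<in> S"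
    and meet: "verts (token_block I f s) \<inter> verts (token_block I f s') \<noteq> {}"
  shows "token_block I f s = token_block I f s'"
proof -
  define K where "K s = {c. (link I f)\<^sup>*\<^sup>* s c}" for s
  have KS: "K s \<subseteq> S" "K s' \<subseteq> S"
    unfolding K_def using link_component_sub[of I f S s] link_component_sub[of I f S s'] assms(1,3,4) by blast+
  have verts: "verts (token_block I f s) = K s \<union> {b \<in> I. f (b, True) \<in> K s}" for s
    by (simp add: token_block_def K_def)
  obtain c where c: "c \<in> K s" "c \<in> K s'"
    using meet KS assms(2) unfolding verts by blast
  then have "(link I f)\<^sup>*\<^sup>* s c" "(link I f)\<^sup>*\<^sup>* s' c" by (auto simp: K_def)
  then have "(link I f)\<^sup>*\<^sup>* s s'" "(link I f)\<^sup>*\<^sup>* s' s"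
    using link_sym by (metis rtranclp_trans)+
  then have "K s = K s'" unfolding K_def by (auto intro: rtranclp_trans)
  then show ?thesis by (simp add: token_block_def K_def)
qed

section \<open>Assembling the factor\<close>

lemma simple_graph_loopfree: "simple_graph G \<Longrightarrow> {v} \<notin> edges G"
  by (auto simp: simple_graph_def)

theorem isolated_condition_factor_nat:
  fixes G :: "nat graph"
  assumes G: "simple_graph G" and "2 \<le> k"
    and iso: "\<And>X. X \<subseteq> verts G \<Longrightarrow> 2 * card (isol (edges G) (verts G - X)) \<le> (2 * k + 1) * card X"
  shows "has_factor (star ` {1..k} \<union> T_family k) G"
proof -
  define V E where "V = verts G" and "E = edges G"
  have finV: "finite V" using G by (simp add: simple_graph_def V_def)
  have loopfree: "{v} \<notin> E" for v using simple_graph_loopfree[OF G] by (simp add: E_def)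
  have iso: "2 * card (isol E (V - X)) \<le> (2 * k + 1) * card X" if "X \<subseteq> V" for X
    using iso that by (simp add: V_def E_def)
  let ?m = "\<lambda>X. int (card (isol E (V - X))) - int (k * card X)"
  have "Max (?m ` Pow V) \<in> ?m ` Pow V" using finV by (intro Max_in) auto
  then obtain S where S: "S \<subseteq> V" and "Max (?m ` Pow V) = ?m S" by auto
  then have max: "?m X \<le> ?m S" if "X \<subseteq> V" for X
    using Max_ge[of "?m ` Pow V" "?m X"] finV that by auto
  define I where "I = isol E (V - S)"
  define W where "W = V - S - I"
  have I: "I \<subseteq> V - S" by (auto simp: I_def isol_def)
  have finite: "finite S" "finite I" "finite W"
    using finV S by (auto simp: W_def I_def isol_def intro: finite_subset)
  have noE: "{u, b} \<notin> E" if "b \<in> I" "u \<in> V - S" for u b using that by (auto simp: I_def isol_def)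
  \<comment> \<open>Enlarging \<open>S\<close> by \<open>X\<close> keeps \<open>I\<close> isolated
    and isolates these vertices as well, so maximality of \<open>S\<close> bounds their number by
    the cost of \<open>X\<close>.\<close>
  have "card (isol E (W - X)) \<le> k * card X" if X: "X \<subseteq> W" for X
  proof -
    have "isol E (W - X) \<union> I \<subseteq> isol E (V - (S \<union> X))"
    proof
      fix v assume v: "v \<in> isol E (W - X) \<union> I"
      have "{u, v} \<notin> E" if u: "u \<in> V - (S \<union> X)" for u
      proof (cases "v \<in> I \<or> u \<in> I")
        case True
        then show ?thesis using noE[of v u] noE[of u v] u v I by (auto simp: insert_commute isol_def W_def)
      next
        case False
        then show ?thesis using u v by (auto simp: isol_def W_def)
      qed
      then show "v \<in> isol E (V - (S \<union> X))" using v X I by (auto simp: isol_def W_def)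
    qed
    then have "card (isol E (W - X) \<union> I) \<le> card (isol E (V - (S \<union> X)))"
      using finV by (intro card_mono) (auto simp: isol_def)
    moreover have "card (isol E (W - X) \<union> I) = card (isol E (W - X)) + card I"
      using finite by (intro card_Un_disjoint) (auto simp: isol_def W_def)
    moreover have "card (S \<union> X) = card S + card X"
      using finite X finite_subset[OF X finite(3)] by (intro card_Un_disjoint) (auto simp: W_def)
    moreover have "?m (S \<union> X) \<le> ?m S" using max[of "S \<union> X"] S X by (auto simp: W_def)
    ultimately have "int (card (isol E (W - X))) \<le> int (k * card X)"
      by (simp add: I_def[symmetric] algebra_simps)
    then show ?thesis unfolding of_nat_le_iff .
  qed
  then obtain h where h: "star_map E W h"
    "\<And>c. c \<in> W \<Longrightarrow> h c = c \<Longrightarrow> 2 \<le> card (fiber W h c) \<and> card (fiber W h c) \<le> k + 1"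
    using star_partition[OF finite(3) loopfree \<open>2 \<le> k\<close>] by blast
  define N where "N b = {s \<in> S. {s, b} \<in> E}" for b
  have NI: "u \<in> N b" if "b \<in> I" "u \<in> V" "{u, b} \<in> E" for b u
    using noE[OF that(1), of u] that by (auto simp: N_def)
  obtain f where f: "\<And>b j. b \<in> I \<Longrightarrow> f (b, j) \<in> N b"
    "\<And>s. s \<in> S \<Longrightarrow> load I f s \<in> {2 * k, 2 * k + 1}"
    "\<And>b. b \<in> I \<Longrightarrow> split_at f b \<Longrightarrow> \<not> (link (I - {b}) f)\<^sup>*\<^sup>* (f (b, True)) (f (b, False))"
    "\<And>b s. b \<in> I \<Longrightarrow> split_at f b \<Longrightarrow> s \<in> ends f b \<Longrightarrow> load I f s = 2 * k + 1"
  proof (rule forest_assignment[OF finite(2,1), of N k])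
    show "N b \<subseteq> S" for b by (auto simp: N_def)
    show "N b \<noteq> {}" if b: "b \<in> I" for b
    proof -
      have "card (isol E V) = 0" using iso[of "{}"] by simp
      then have "isol E V = {}" using finV by (simp add: isol_def)
      moreover have "b \<in> V" using b I by auto
      ultimately obtain u where "u \<in> V" "{u, b} \<in> E" by (auto simp: isol_def)
      then show ?thesis using NI[OF b] by auto
    qed
    \<comment> \<open>The counted vertices are isolated once \<open>Y\<close> is deleted, so the
      hypothesis applies to \<open>Y\<close>.\<close>
    show "2 * card {b \<in> I. N b \<subseteq> Y} \<le> (2 * k + 1) * card Y" if Y: "Y \<subseteq> S" for Y
    proof -
      have "{b \<in> I. N b \<subseteq> Y} \<subseteq> isol E (V - Y)" using NI I Y unfolding isol_def by blast
      then have "card {b \<in> I. N b \<subseteq> Y} \<le> card (isol E (V - Y))"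
        using finV by (intro card_mono) (auto simp: isol_def)
      moreover have "Y \<subseteq> V" using Y S by simp
      ultimately show ?thesis using iso[of Y] by linarith
    qed
    \<comment> \<open>Removing \<open>Y\<close> from \<open>S\<close> saves
      \<open>k * card Y\<close> and loses at most the isolated vertices that see \<open>Y\<close>;
      by maximality the saving is no larger than the loss.\<close>
    show "k * card Y \<le> card {b \<in> I. N b \<inter> Y \<noteq> {}}" if Y: "Y \<subseteq> S" for Y
    proof -
      have "I - {b \<in> I. N b \<inter> Y \<noteq> {}} \<subseteq> isol E (V - (S - Y))"
        using NI I by (fastforce simp: isol_def N_def)
      then have "card (I - {b \<in> I. N b \<inter> Y \<noteq> {}}) \<le> card (isol E (V - (S - Y)))"
        using finV by (intro card_mono) (auto simp: isol_def)
      moreover have "card (I - {b \<in> I. N b \<inter> Y \<noteq> {}}) = card I - card {b \<in> I. N b \<inter> Y \<noteq> {}}"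
        using finite by (intro card_Diff_subset) auto
      moreover have "card {b \<in> I. N b \<inter> Y \<noteq> {}} \<le> card I" using finite by (intro card_mono) auto
      moreover have "card (S - Y) = card S - card Y" "card Y \<le> card S"
        using finite Y finite_subset[OF Y finite(1)] by (auto intro: card_Diff_subset card_mono)
      moreover have "?m (S - Y) \<le> ?m S" using max[of "S - Y"] S by auto
      ultimately have "int (k * card Y) \<le> int (card {b \<in> I. N b \<inter> Y \<noteq> {}})"
        by (simp add: I_def[symmetric] algebra_simps of_nat_diff)
      then show ?thesis unfolding of_nat_le_iff .
    qed
  qed (rule that)
  have inS: "f (b, j) \<in> S" if "b \<in> I" for b j using f(1)[OF that, of j] by (auto simp: N_def)
  have disj: "I \<inter> S = {}" using I by auto
  define L where "L c = {v \<in> W. v \<noteq> c \<and> h v = c}" for c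
  define C where "C = {c \<in> W. h c = c}"
  have fiber: "fiber W h c = insert c (L c)" if "c \<in> C" for c
    using that by (auto simp: fiber_def L_def C_def)
  have L: "finite (L c)" "c \<notin> L c" "card (L c) \<in> {1..k}" if "c \<in> C" for c
  proof -
    show *: "finite (L c)" "c \<notin> L c" using finite by (auto simp: L_def)
    show "card (L c) \<in> {1..k}" using h(2)[of c] fiber[OF that] * that by (auto simp: C_def)
  qed
  have block: "connected_graph (token_block I f s)"
    "\<exists>H \<in> star ` {1..k} \<union> T_family k. isomorphic (token_block I f s) H" if "s \<in> S" for s
    by (rule token_block_factor[OF finite(2,1) disj \<open>2 \<le> k\<close> that]; fact inS f(2-4))+
  let ?A = "(\<lambda>c. star_at c (L c)) ` C" and ?B = "token_block I f ` S"
  have vA: "verts (star_at c (L c)) \<subseteq> W" if "c \<in> C" for c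
    using that by (auto simp: star_at_def L_def C_def)
  have vB: "verts (token_block I f s) \<subseteq> S \<union> I" if "s \<in> S" for s
    using link_component_sub[of I f S s] inS that by (auto simp: token_block_def)
  show ?thesis
  proof (rule has_factor_blocks[OF G, of "?A \<union> ?B"])
    show "\<Union> (verts ` (?A \<union> ?B)) = verts G"
    proof
      show "\<Union> (verts ` (?A \<union> ?B)) \<subseteq> verts G" using vA vB S I by (fastforce simp: W_def V_def)
      show "verts G \<subseteq> \<Union> (verts ` (?A \<union> ?B))"
      proof
        fix v assume "v \<in> verts G"
        then consider "v \<in> W" | "v \<in> S" | "v \<in> I" by (auto simp: W_def V_def)
        then show "v \<in> \<Union> (verts ` (?A \<union> ?B))"
        proof cases
          case 1
          then have "h v \<in> C" "v \<in> verts (star_at (h v) (L (h v)))"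
            using h(1) by (auto simp: star_map_def C_def star_at_def L_def)
          then show ?thesis by blast
        next
          case 2
          then have "v \<in> verts (token_block I f v)" by (simp add: token_block_def)
          then show ?thesis using 2 by blast
        next
          case 3
          then have "v \<in> verts (token_block I f (f (v, True)))" by (simp add: token_block_def)
          then show ?thesis using inS[OF 3] by blast
        qed
      qed
    qed
    show "verts A \<inter> verts B = {}" if A: "A \<in> ?A \<union> ?B" and B: "B \<in> ?A \<union> ?B" and "A \<noteq> B" for A B
    proof -
      have mixed: "verts (star_at c (L c)) \<inter> verts (token_block I f s) = {}" if "c \<in> C" "s \<in> S" for c s
        using vA[OF that(1)] vB[OF that(2)] by (auto simp: W_def)
      have stars: "verts (star_at c (L c)) \<inter> verts (star_at d (L d)) = {}" if "c \<in> C" "d \<in> C" "c \<noteq> d" for c d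
        using that by (auto simp: star_at_def L_def C_def)
      have trees: "verts (token_block I f s) \<inter> verts (token_block I f s') = {}"
        if "s \<in> S" "s' \<in> S" "token_block I f s \<noteq> token_block I f s'" for s s'
        using token_block_disjoint[of I f S s s'] inS disj that by blast
      show ?thesis using A B \<open>A \<noteq> B\<close> mixed stars trees by (elim UnE imageE) (simp_all add: Int_commute, blast+)
    qed
    show "edges B \<subseteq> edges G" if "B \<in> ?A \<union> ?B" for B
    proof
      fix e assume e: "e \<in> edges B"
      from that consider c where "c \<in> C" "B = star_at c (L c)" | s where "s \<in> S" "B = token_block I f s" by auto
      then show "e \<in> edges G"
      proof cases
        case 1
        then obtain x where "x \<in> L c" "e = {c, x}" using e by (auto simp: star_at_def)
        then show ?thesis using h(1) by (auto simp: L_def star_map_def E_def insert_commute)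
      next
        case 2
        then obtain b j where "b \<in> I" "e = {b, f (b, j)}" using e by (auto simp: token_block_def)
        then show ?thesis using f(1)[of b j] by (simp add: N_def E_def insert_commute)
      qed
    qed
    show "e \<subseteq> verts B" if B: "B \<in> ?A \<union> ?B" and e: "e \<in> edges B" for B e
    proof -
      from B consider c where "c \<in> C" "B = star_at c (L c)" | s where "s \<in> S" "B = token_block I f s" by auto
      then show ?thesis
      proof cases
        case 1
        then show ?thesis using e by (auto simp: star_at_def)
      next
        case 2
        obtain b j where b: "b \<in> I" "(link I f)\<^sup>*\<^sup>* s (f (b, True))" "e = {b, f (b, j)}"
          using e 2 by (auto simp: token_block_def)
        have "link I f (f (b, True)) (f (b, j))" using b(1) by (auto simp: link_def intro: in_ends)
        then have "(link I f)\<^sup>*\<^sup>* s (f (b, j))" using b(2) by simp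
        then show ?thesis using b 2 by (simp add: token_block_def)
      qed
    qed
    show "connected_graph B" if "B \<in> ?A \<union> ?B" for B
      using that star_at_connected block(1) by auto
    show "\<exists>H\<in>star ` {1..k} \<union> T_family k. isomorphic B H" if "B \<in> ?A \<union> ?B" for B
      using that
    proof
      assume "B \<in> ?A"
      then obtain c where c: "c \<in> C" "B = star_at c (L c)" by auto
      have "isomorphic B (star (card (L c)))" unfolding c(2) by (rule star_at_isomorphic[OF L(1,2)[OF c(1)]])
      moreover have "star (card (L c)) \<in> star ` {1..k}" using L(3)[OF c(1)] by (rule imageI)
      ultimately show ?thesis by blast
    next
      assume "B \<in> ?B"
      then show ?thesis using block(2) by auto
    qed
  qed
qed

section \<open>Transport along an injective relabelling\<close>

lemma reachable_image:
  assumes "reachable G u v" "\<And>x y. {x, y} \<in> edges G \<Longrightarrow> {\<phi> x, \<phi> y} \<in> edges H"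
  shows "reachable H (\<phi> u) (\<phi> v)"
  using assms(1) unfolding reachable_def
  by (induction rule: rtranclp_induct) (auto dest: assms(2) intro: rtranclp.rtrancl_into_rtrancl)

text \<open>The factor is pulled back by keeping the edges whose images it contains;
  \<open>\<phi>\<close> then maps components isomorphically onto components.\<close>

lemma has_factor_image:
  fixes G :: "'a graph" and \<phi> :: "'a \<Rightarrow> 'b"
  assumes G: "simple_graph G" and inj: "inj_on \<phi> (verts G)"
    and "has_factor \<H> \<lparr>verts = \<phi> ` verts G, edges = image \<phi> ` edges G\<rparr>"
  shows "has_factor \<H> G"
proof -
  obtain F' where F': "verts F' = \<phi> ` verts G" "edges F' \<subseteq> image \<phi> ` edges G"
    and comp': "\<And>C. C \<in> components F' \<Longrightarrow> \<exists>H\<in>\<H>. isomorphic C H"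
    using assms(3) by (auto simp: has_factor_def is_factor_def spanning_subgraph_def)
  define F where "F = \<lparr>verts = verts G, edges = {e \<in> edges G. \<phi> ` e \<in> edges F'}\<rparr>"
  have EG: "e \<subseteq> verts G" if "e \<in> edges G" for e using G that by (auto simp: simple_graph_def)
  have edge: "{\<phi> x, \<phi> y} \<in> edges F' \<longleftrightarrow> {x, y} \<in> edges F" if "x \<in> verts G" "y \<in> verts G" for x y
  proof
    assume e: "{\<phi> x, \<phi> y} \<in> edges F'"
    then obtain e where "e \<in> edges G" "\<phi> ` {x, y} = \<phi> ` e" using F'(2) by auto
    then have "{x, y} = e" using inj_on_image_eq_iff[OF inj, of "{x, y}" e] that EG by auto
    then have "{x, y} \<in> edges G" using \<open>e \<in> edges G\<close> by simp
    then show "{x, y} \<in> edges F" using e by (simp add: F_def)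
  qed (simp add: F_def)
  have fwd: "reachable F' (\<phi> u) (\<phi> v)" if "reachable F u v" for u v
    using that by (rule reachable_image) (simp add: F_def)
  have bwd: "\<exists>v\<in>verts G. w = \<phi> v \<and> reachable F u v" if "reachable F' (\<phi> u) w" "u \<in> verts G" for u w
    using that(1) unfolding reachable_def
  proof (induction rule: rtranclp_induct)
    case base
    then show ?case using that(2) by auto
  next
    case (step y z)
    then obtain v where v: "v \<in> verts G" "y = \<phi> v" "reachable F u v" by (auto simp: reachable_def)
    obtain e where e: "e \<in> edges G" "{y, z} = \<phi> ` e" using step.hyps(2) F'(2) by auto
    then have "z \<in> \<phi> ` e" by auto
    then obtain x where x: "x \<in> verts G" "z = \<phi> x" using EG[OF e(1)] by auto
    then have "{v, x} \<in> edges F" using edge v step.hyps(2) by auto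
    then show ?case using v(3) x by (auto simp: reachable_def intro: rtranclp.rtrancl_into_rtrancl)
  qed
  have "\<exists>H\<in>\<H>. isomorphic C H" if C: "C \<in> components F" for C
  proof -
    obtain v where v: "v \<in> verts G" "C = induced F {u \<in> verts F. reachable F v u}"
      using C by (auto simp: components_def F_def)
    define C' where "C' = induced F' {u \<in> verts F'. reachable F' (\<phi> v) u}"
    have verts: "verts C = {u \<in> verts G. reachable F v u}" "verts C' = {u \<in> verts F'. reachable F' (\<phi> v) u}"
      by (auto simp: v C'_def induced_def F_def)
    have "\<phi> ` verts C = verts C'"
      unfolding verts F'(1) using bwd[OF _ v(1)] fwd by blast
    moreover have "inj_on \<phi> (verts C)" using inj by (rule inj_on_subset) (auto simp: verts)
    moreover have "{x, y} \<in> edges C \<longleftrightarrow> {\<phi> x, \<phi> y} \<in> edges C'" if "x \<in> verts C" "y \<in> verts C" for x y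
    proof -
      have "\<phi> x \<in> verts C'" "\<phi> y \<in> verts C'" using \<open>\<phi> ` verts C = verts C'\<close> that by auto
      moreover have "{x, y} \<in> edges C \<longleftrightarrow> {x, y} \<in> edges F"
        using that unfolding verts by (auto simp: v induced_def F_def)
      moreover have "{\<phi> x, \<phi> y} \<in> edges C' \<longleftrightarrow> {\<phi> x, \<phi> y} \<in> edges F'"
        using \<open>\<phi> x \<in> verts C'\<close> \<open>\<phi> y \<in> verts C'\<close> unfolding verts by (auto simp: C'_def induced_def)
      ultimately show ?thesis using edge[of x y] that unfolding verts by auto
    qed
    ultimately have "isomorphic C C'" unfolding isomorphic_def bij_betw_def by blast
    moreover have "C' \<in> components F'" using v(1) F'(1) by (auto simp: C'_def components_def)
    ultimately show ?thesis using comp' isomorphic_trans by blast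
  qed
  then have "is_factor \<H> F G" by (auto simp: is_factor_def spanning_subgraph_def F_def)
  then show ?thesis by (auto simp: has_factor_def)
qed

lemma simple_graph_image:
  assumes "simple_graph G" "inj_on \<phi> (verts G)"
  shows "simple_graph \<lparr>verts = \<phi> ` verts G, edges = image \<phi> ` edges G\<rparr>"
  using assms by (auto simp: simple_graph_def card_image inj_on_subset)

lemma isol_image:
  assumes G: "simple_graph G" and inj: "inj_on \<phi> (verts G)" and U: "U \<subseteq> verts G"
  shows "isol (image \<phi> ` edges G) (\<phi> ` U) = \<phi> ` isol (edges G) U"
proof -
  have "{\<phi> x, \<phi> y} \<in> image \<phi> ` edges G \<longleftrightarrow> {x, y} \<in> edges G" if "x \<in> U" "y \<in> U" for x y
  proof
    assume "{\<phi> x, \<phi> y} \<in> image \<phi> ` edges G"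
    then obtain e where e: "e \<in> edges G" "\<phi> ` {x, y} = \<phi> ` e" by auto
    then have "{x, y} = e"
      using inj_on_image_eq_iff[OF inj, of "{x, y}" e] that U G by (auto simp: simple_graph_def)
    then show "{x, y} \<in> edges G" using e by simp
  next
    assume "{x, y} \<in> edges G"
    then have "\<phi> ` {x, y} \<in> image \<phi> ` edges G" by (rule imageI)
    then show "{\<phi> x, \<phi> y} \<in> image \<phi> ` edges G" by simp
  qed
  then show ?thesis by (auto simp: isol_def)
qed

text \<open>The passage to \<open>nat\<close> is needed because \<open>T_family\<close> only contains graphs on natural numbers.\<close>

theorem isolated_condition_factor:
  fixes G :: "'a graph"
  assumes G: "simple_graph G" and "2 \<le> k"
    and iso: "\<And>X. X \<subseteq> verts G \<Longrightarrow> 2 * card (isol (edges G) (verts G - X)) \<le> (2 * k + 1) * card X"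
  shows "has_factor (star ` {1..k} \<union> T_family k) G"
proof -
  obtain \<phi> :: "'a \<Rightarrow> nat" where inj: "inj_on \<phi> (verts G)"
    using G finite_imp_inj_to_nat_seg by (fastforce simp: simple_graph_def)
  let ?G = "\<lparr>verts = \<phi> ` verts G, edges = image \<phi> ` edges G\<rparr>"
  have "2 * card (isol (edges ?G) (verts ?G - Y)) \<le> (2 * k + 1) * card Y" if "Y \<subseteq> verts ?G" for Y
  proof -
    from that obtain X where X: "X \<subseteq> verts G" "Y = \<phi> ` X" by (auto simp: subset_image_iff)
    have "verts ?G - Y = \<phi> ` (verts G - X)"
      using X inj_on_image_set_diff[OF inj, of "verts G" X] by auto
    then have "isol (edges ?G) (verts ?G - Y) = \<phi> ` isol (edges G) (verts G - X)"
      using isol_image[OF G inj, of "verts G - X"] by simp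
    moreover have "inj_on \<phi> (isol (edges G) (verts G - X))" "inj_on \<phi> X"
      using inj X by (auto simp: isol_def intro: inj_on_subset)
    ultimately show ?thesis using iso[OF X(1)] X(2) by (simp add: card_image)
  qed
  then have "has_factor (star ` {1..k} \<union> T_family k) ?G"
    using simple_graph_image[OF G inj] \<open>2 \<le> k\<close> by (intro isolated_condition_factor_nat)
  then show ?thesis by (rule has_factor_image[OF G inj])
qed

text \<open>Vertices of \<open>J\<close> have neighbours only in \<open>S\<close>, so an edge either
  avoids \<open>J\<close> or joins it to \<open>S\<close>. Taking a subset of the isolated vertices
  allows its size to be prescribed.\<close>

lemma card_edges_le:
  assumes G: "simple_graph G" and S: "S \<subseteq> verts G" and J: "J \<subseteq> isol (edges G) (verts G - S)"
  shows "card (edges G) \<le> ((card (verts G) - card J) choose 2) + card S * card J"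
proof -
  let ?A = "{e. e \<subseteq> verts G - J \<and> card e = 2}" and ?B = "(\<lambda>(s, b). {s, b}) ` (S \<times> J)"
  have fin: "finite (verts G)" using G by (simp add: simple_graph_def)
  have JV: "J \<subseteq> verts G - S" using J by (auto simp: isol_def)
  have finJ: "finite J" "finite S" using JV S fin by (auto intro: finite_subset)
  have "edges G \<subseteq> ?A \<union> ?B"
  proof
    fix e assume e: "e \<in> edges G"
    then have eV: "e \<subseteq> verts G" "card e = 2" using G by (auto simp: simple_graph_def)
    show "e \<in> ?A \<union> ?B"
    proof (cases "e \<inter> J = {}")
      case False
      then obtain b where b: "b \<in> e" "b \<in> J" by auto
      then obtain s where s: "e = {s, b}" using eV(2) by (metis card_2_iff insert_commute insertE singletonD)
      then have "s \<in> S" using e b J eV(1) by (auto simp: isol_def)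
      then show ?thesis using s b by auto
    qed (use eV in auto)
  qed
  moreover have "finite ?A" using fin by (auto intro: finite_subset[of _ "Pow (verts G)"])
  ultimately have "card (edges G) \<le> card (?A \<union> ?B)" using finJ by (intro card_mono) auto
  also have "\<dots> \<le> card ?A + card ?B" by (rule card_Un_le)
  also have "card ?A = (card (verts G - J)) choose 2" using fin by (intro n_subsets) auto
  also have "card (verts G - J) = card (verts G) - card J" using JV finJ by (intro card_Diff_subset) auto
  also have "card ?B \<le> card (S \<times> J)" using finJ by (intro card_image_le) auto
  finally show ?thesis by (simp add: card_cartesian_product)
qed

section \<open>Counting edges\<close>

text \<open>The left side is the bound of \<open>card_edges_le\<close>, and \<open>s = t\<close>,
  where \<open>j = q + 1\<close>, is its worst case. For \<open>s = t + 1\<close> the condition on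
  \<open>n\<close> is used. For larger \<open>s\<close> the gain is quadratic in \<open>d\<close>,
  which is about \<open>(k + 1/2) * e\<close>, and outweighs the loss \<open>2 * e * (q + 1)\<close>
  because \<open>t < k\<close>.\<close>

lemma isolated_count_bound:
  fixes k t s n :: nat
  defines "q \<equiv> (2 * k + 1) * t div 2" and "j \<equiv> (2 * k + 1) * s div 2 + 1"
  assumes "2 \<le> k" "t \<le> k - 1" "t \<le> s" "j + s \<le> n"
    and n: "(2 * k\<^sup>2 + 5 * k + 1) * t + k\<^sup>2 + 5 * k + 2 \<le> 2 * k * n"
  shows "((n - j) choose 2) + s * j \<le> ((n - q - 1) choose 2) + t * (q + 1)"
proof (cases "s = t")
  case False
  define e where "e = s - t"
  have s: "s = t + e" "1 \<le> e" using \<open>t \<le> s\<close> False by (auto simp: e_def)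
  have "q + 1 \<le> j" unfolding q_def j_def using \<open>t \<le> s\<close> by (simp add: div_le_mono mult_le_mono del: mult_Suc)
  define d where "d = j - (q + 1)"
  have j: "j = q + 1 + d" using \<open>q + 1 \<le> j\<close> by (simp add: d_def)
  define m where "m = n - q - 1"
  have nm: "n = m + q + 1" "d + s \<le> m" using \<open>j + s \<le> n\<close> by (auto simp: m_def j)
  \<comment> \<open>Right side minus left side here is twice the corresponding difference in the
    claim.\<close>
  have key: "2 * int e * (int q + 1) \<le> int d * (2 * int m - int d - 1 - 2 * int e - 2 * int t)"
  proof (cases "e = 1")
    case True
    have n': "(2 * (int k)\<^sup>2 + 5 * int k + 1) * int t + (int k)\<^sup>2 + 5 * int k + 2 \<le> 2 * int k * (int m + int q + 1)"
    proof -
      have "int ((2 * k\<^sup>2 + 5 * k + 1) * t + k\<^sup>2 + 5 * k + 2) \<le> int (2 * k * (m + q + 1))"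
        using n unfolding nm(1) of_nat_le_iff .
      then show ?thesis by (simp add: algebra_simps)
    qed
    show ?thesis
    proof (cases "even t")
      case even: True
      then obtain u where u: "t = 2 * u" by auto
      have q: "q = (2 * k + 1) * u" unfolding q_def u by simp
      have "(2 * k + 1) * s = 2 * ((2 * k + 1) * u + k) + 1" unfolding s(1) True u by (simp add: algebra_simps)
      then have "j = (2 * k + 1) * u + k + 1" unfolding j_def by simp
      then have "d = k" by (simp add: d_def q)
      \<comment> \<open>For even \<open>t\<close> the gap \<open>d\<close> is \<open>k\<close>, and
        \<open>key\<close> is exactly the condition on \<open>n\<close>: this is the origin of its
        coefficients.\<close>
      then show ?thesis using n' unfolding True u q by (simp add: algebra_simps power2_eq_square)
    next
      case odd: False
      then obtain u where u: "t = 2 * u + 1" by (auto elim: oddE)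
      have "(2 * k + 1) * t = 2 * ((2 * k + 1) * u + k) + 1" unfolding u by (simp add: algebra_simps)
      then have q: "q = (2 * k + 1) * u + k" unfolding q_def by simp
      have "(2 * k + 1) * s = 2 * ((2 * k + 1) * (u + 1))" unfolding s(1) True u by (simp add: algebra_simps)
      then have "j = (2 * k + 1) * (u + 1) + 1" unfolding j_def by simp
      then have d: "d = k + 1" by (simp add: d_def q)
      have 1: "(4 * int k + 2) * int u + 2 * int k + 3 \<le> 2 * int k * int m - (int k)\<^sup>2 - 6 * int k - 4 * int u * int k"
        using n' unfolding u q by (simp add: algebra_simps power2_eq_square)
      \<comment> \<open>For odd \<open>t\<close> the gap is \<open>k + 1\<close> and there is slack.
        The condition on \<open>n\<close> bounds a multiple of \<open>k\<close>, so the goal is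
        multiplied by \<open>k\<close>, which is cancelled at the end.\<close>
      have "int k * (2 * ((2 * int k + 1) * int u + int k + 1))
          \<le> (int k + 1) * ((4 * int k + 2) * int u + 2 * int k + 3)"
        by (simp add: algebra_simps)
      also have "\<dots> \<le> (int k + 1) * (2 * int k * int m - (int k)\<^sup>2 - 6 * int k - 4 * int u * int k)"
        using 1 by (intro mult_left_mono) auto
      also have "\<dots> = int k * ((int k + 1) * (2 * int m - int k - 6 - 4 * int u))"
        by (simp add: algebra_simps power2_eq_square)
      finally have "2 * ((2 * int k + 1) * int u + int k + 1) \<le> (int k + 1) * (2 * int m - int k - 6 - 4 * int u)"
        using \<open>2 \<le> k\<close> by (simp add: mult_le_cancel_left)
      then show ?thesis unfolding True u q d by (simp add: algebra_simps)
    qed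
  next
    case False
    then have e2: "2 \<le> e" using s by simp
    \<comment> \<open>Doubling removes the roundings, each of which costs at most one half; this
      gives \<open>2 * d \<ge> (2 * k + 1) * e - 1\<close> for either parity.\<close>
    have jd: "2 * j \<ge> (2 * k + 1) * s + 1" "2 * q \<le> (2 * k + 1) * t" unfolding j_def q_def by presburger+
    then have "(2 * k + 1) * e \<le> 2 * d + 1" unfolding j s(1) by (simp add: algebra_simps)
    then have d: "(2 * int k + 1) * int e - 1 \<le> 2 * int d"
      by (simp add: algebra_simps flip: of_nat_le_iff[where 'a = int])
    have "2 * int q + 2 \<le> (2 * int k + 1) * int t + 2"
      using jd(2) by (simp add: algebra_simps flip: of_nat_le_iff[where 'a = int])
    also have "\<dots> \<le> (2 * int k + 1) * (int k - 1) + 2"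
      using \<open>t \<le> k - 1\<close> \<open>2 \<le> k\<close> by (intro add_right_mono mult_left_mono) auto
    finally have q: "4 * (2 * int q + 2) \<le> 8 * (int k)\<^sup>2 - 4 * int k + 4"
      by (simp add: algebra_simps power2_eq_square)
    have "8 * (int k)\<^sup>2 + 4 * int k + 8 \<le> (2 * int k + 1)\<^sup>2 * 2"
      using \<open>2 \<le> k\<close> by (simp add: algebra_simps power2_eq_square)
    also have "\<dots> \<le> (2 * int k + 1)\<^sup>2 * int e" using e2 by (intro mult_left_mono) auto
    finally have "4 * (2 * int q + 2) \<le> (2 * int k + 1)\<^sup>2 * int e - 4 * (2 * int k + 1)" using q by simp
    then have "int e * (4 * (2 * int q + 2)) \<le> int e * ((2 * int k + 1)\<^sup>2 * int e - 4 * (2 * int k + 1))"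
      by (intro mult_left_mono) auto
    also have "\<dots> \<le> ((2 * int k + 1) * int e - 1) * ((2 * int k + 1) * int e - 3)"
      by (simp add: algebra_simps power2_eq_square)
    also have "\<dots> \<le> (2 * int d) * (2 * int d - 2)"
    proof (rule mult_mono)
      have "2 * 2 \<le> (2 * int k + 1) * int e" using e2 \<open>2 \<le> k\<close> by (intro mult_mono) auto
      then show "0 \<le> (2 * int k + 1) * int e - 3" by simp
    qed (use d in auto)
    finally have "2 * int e * (int q + 1) \<le> int d * (int d - 1)"
      by (simp add: algebra_simps)
    \<comment> \<open>Since \<open>d + s \<le> m\<close>, the second factor is at least
      \<open>d - 1\<close>.\<close>
    also have "\<dots> \<le> int d * (2 * int m - int d - 1 - 2 * int e - 2 * int t)"
      using nm(2) s(1) by (intro mult_left_mono) auto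
    finally show ?thesis .
  qed
  define r where "r = m - d"
  have m: "m = r + d" using nm(2) by (simp add: r_def)
  have ch: "2 * int (x choose 2) = int x * (int x - 1)" for x :: nat
  proof -
    have "2 * (x choose 2) = x * (x - 1)"
      unfolding choose_two by (rule dvd_mult_div_cancel) (cases x; auto)
    then have "2 * int (x choose 2) = int (x * (x - 1))" by (metis of_nat_mult of_nat_numeral)
    then show ?thesis by (cases x) (auto simp: algebra_simps)
  qed
  have "int ((r choose 2) + s * j) \<le> int ((m choose 2) + t * (q + 1))"
    using key ch[of r] ch[of m] unfolding s(1) j m by (simp add: algebra_simps)
  moreover have "n - j = r" "n - q - 1 = m" by (simp_all add: r_def m_def j)
  ultimately show ?thesis by (simp only: of_nat_le_iff)
qed (simp add: q_def j_def)

text \<open>Excludes sets with fewer than \<open>t\<close> vertices: deleting them leaves a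
  connected graph, where an isolated vertex has to be the only one.\<close>

lemma isol_del_verts_connected:
  assumes "connected_graph (del_verts G X)" "v \<in> isol (edges G) (verts G - X)" "X \<subseteq> verts G"
  shows "verts G - X = {v}"
proof -
  have v: "v \<in> verts G - X" using assms(2) by (simp add: isol_def)
  have "u = v" if u: "u \<in> verts G - X" for u
  proof (rule ccontr)
    assume "u \<noteq> v"
    have "reachable (del_verts G X) v u"
      using assms(1) u v by (auto simp: connected_graph_def del_verts_def induced_def)
    then obtain w where "{v, w} \<in> edges (del_verts G X)"
      unfolding reachable_def using \<open>u \<noteq> v\<close> by (auto elim: converse_rtranclpE)
    then have "{w, v} \<in> edges G" "w \<in> verts G - X"
      by (auto simp: del_verts_def induced_def insert_commute)
    then show False using assms(2) by (auto simp: isol_def)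
  qed
  then show ?thesis using v by blast
qed

theorem theorem1p3:
  fixes G :: "'a graph" and k t n :: nat
  assumes "simple_graph G"
    and "k \<ge> 2" and "1 \<le> t" and "t \<le> k - 1"
    and "t_connected t G"
    and "n = card (verts G)"
    and "real n \<ge> ((2 * real k ^ 2 + 5 * real k + 1) * real t + real k ^ 2 + 5 * real k + 2)
                    / (2 * real k)"
    and "card (edges G) > ((n - nat \<lfloor>(real k + 1 / 2) * real t\<rfloor> - 1) choose 2)
                            + t * (nat \<lfloor>(real k + 1 / 2) * real t\<rfloor> + 1)"
  shows "has_factor (star ` {1..k} \<union> T_family k) G"
proof (rule isolated_condition_factor)
  fix X assume X: "X \<subseteq> verts G"
  let ?q = "(2 * k + 1) * t div 2"
  have fin: "finite (verts G)" using assms(1) by (simp add: simple_graph_def)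
  have "(real k + 1 / 2) * real t = real ((2 * k + 1) * t) / real 2" by (simp add: field_simps)
  then have "nat \<lfloor>(real k + 1 / 2) * real t\<rfloor> = ?q"
    by (simp only: floor_divide_of_nat_eq nat_int)
  then have dense: "((n - ?q - 1) choose 2) + t * (?q + 1) < card (edges G)" using assms(8) by simp
  have "real ((2 * k\<^sup>2 + 5 * k + 1) * t + k\<^sup>2 + 5 * k + 2) \<le> real (2 * k * n)"
    using assms(2,7) by (simp add: field_simps)
  then have large: "(2 * k\<^sup>2 + 5 * k + 1) * t + k\<^sup>2 + 5 * k + 2 \<le> 2 * k * n"
    unfolding of_nat_le_iff .
  show "2 * card (isol (edges G) (verts G - X)) \<le> (2 * k + 1) * card X"
  proof (rule ccontr)
    assume viol: "\<not> ?thesis"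
    \<comment> \<open>The least number of isolated vertices that violates the condition for a set of
      this size.\<close>
    let ?j = "(2 * k + 1) * card X div 2 + 1"
    have j: "?j \<le> card (isol (edges G) (verts G - X))" using viol by linarith
    have "t \<le> card X"
    proof (rule ccontr)
      assume "\<not> t \<le> card X"
      then have conn: "connected_graph (del_verts G X)" using assms(5) X by (auto simp: t_connected_def)
      obtain v where v: "v \<in> isol (edges G) (verts G - X)"
        using j by (metis card.empty equals0I add_is_0 le_zero_eq one_neq_zero)
      have "card (verts G - X) = 1" using isol_del_verts_connected[OF conn v X] by simp
      \<comment> \<open>Then \<open>G\<close> has at most \<open>t\<close> vertices, but a
        \<open>t\<close>-connected graph has more.\<close>
      then have "card (verts G) \<le> card X + 1"
        using card_Diff_subset[of X "verts G"] fin X finite_subset by fastforce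
      then show False using \<open>\<not> t \<le> card X\<close> assms(5) by (simp add: t_connected_def)
    qed
    \<comment> \<open>Keeping exactly \<open>?j\<close> isolated vertices makes the edge bound a
      function of \<open>card X\<close> alone.\<close>
    obtain J where J: "J \<subseteq> isol (edges G) (verts G - X)" "card J = ?j"
      using obtain_subset_with_card_n[OF j] by metis
    have JV: "J \<subseteq> verts G - X" using J(1) by (auto simp: isol_def)
    have "finite J" "finite X" using JV X fin by (auto intro: finite_subset)
    then have "card (J \<union> X) = ?j + card X" using JV J(2) by (subst card_Un_disjoint) auto
    moreover have "card (J \<union> X) \<le> n" unfolding assms(6) using JV X fin by (intro card_mono) auto
    ultimately have "?j + card X \<le> n" by simp
    then have "((n - ?j) choose 2) + card X * ?j \<le> ((n - ?q - 1) choose 2) + t * (?q + 1)"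
      using isolated_count_bound[OF assms(2,4) \<open>t \<le> card X\<close> _ large] by simp
    moreover have "card (edges G) \<le> ((n - ?j) choose 2) + card X * ?j"
      using card_edges_le[OF assms(1) X J(1)] J(2) assms(6) by simp
    ultimately show False using dense by simp
  qed
qed (fact assms(1,2))+

end
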